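(* Let $r,m\ge1$ and let $\xi$ be an $F^r$-stable irreducible character of $G^{F^{rm}}$ together with data $(V_i,T_i)$ as in the context, giving the extension $\tilde\xi$ of $\xi$ to $G^{F^{rm}}\langle\sigma^r\rangle$ and the extension $\tilde\varphi_0$ of $\xi F(\xi)\cdots F^{r-1}(\xi)$ to $G^{F^{rm}}\langle\sigma\rangle$. Put $R^{(m)}_{\tilde\xi}=Sh_{F^{rm}/F^r}(x\mapsto\tilde\xi(x\sigma^r))$ and $c^{(m)}_r(\tilde\xi)=|G^{F^{rm}}|^{-1}\sum_{\hat g\in G^{F^{rm}}}\tilde\xi(N_r(\hat g)\sigma^r)$. (i) $c^{(m)}_r(\tilde\xi)=m_r(R^{(m)}_{\tilde\xi})=\tilde M_{rm}(\tilde\varphi_0)$. In particular $|m_r(R^{(m)}_{\tilde\xi})|\le M_{rm}(\xi F(\xi)\cdots F^{r-1}(\xi))$, and if $M_{rm}(\xi F(\xi)\cdots F^{r-1}(\xi))=1$ then $|m_r(R^{(m)}_{\tilde\xi})|=1$. (ii) If $r=2$, there is a $2m$-th root of unity $\zeta$ such that $m_2(R^{(m)}_{\tilde\xi})=\zeta$ if $\bar\xi=F(\xi)$, and $m_2(R^{(m)}_{\tilde\xi})=0$ otherwise ($\bar\xi$ the complex conjugate character).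
   Context: $G$ is a connected algebraic group defined over $\mathbb F_q$ with Frobenius $F$; $F(\chi)(F(g))=\chi(g)$ for characters; $N_r(x)=xF(x)\cdots F^{r-1}(x)$. $\sigma=F|_{G^{F^{rm}}}$; $G^{F^{rm}}\langle\sigma\rangle$ is the semidirect product with the cyclic group of order $rm$ generated by $\sigma$ ($\sigma g\sigma^{-1}=F(g)$), $G^{F^{rm}}\langle\sigma^r\rangle$ the subgroup generated by $G^{F^{rm}}$ and $\sigma^r$. Shintani descent: for $x\in G^{F^{rm}}$ write $x=\alpha^{-1}F^r(\alpha)$, $x'=F^{rm}(\alpha)\alpha^{-1}\in G^{F^r}$; then $Sh_{F^{rm}/F^r}(f)(x')=f(x)$ defines a map from functions on $F^r$-twisted classes of $G^{F^{rm}}$ to class functions on $G^{F^r}$. $m_r(f)=|G^F|^{-1}\sum_{x\in G^F}f(x)$ for class functions $f$ on $G^{F^r}$; $M_k(h)=|G^{F^k}|^{-1}\sum_{x\in G^{F^k}}h(x)$ for class functions $h$ on $G^{F^k}$; $\tilde M_k(f)=|G^{F^k}|^{-1}\sum_{x\in G^{F^k}}f(x\sigma)$ for functions on $G^{F^k}\langle\sigma\rangle$. Data: $V_i$ ($1\le i\le r$) irreducible $G^{F^{rm}}$-modules affording $F^{i-1}(\xi)$, linear isomorphisms $T_i:V_i\to V_{i+1}$ ($V_{r+1}=V_1$) with $T_i\circ g=F(g)\circ T_i$ and $(T_r\cdots T_1)^m=1$. $\tilde\xi$ is the character of $V_1$ with $\sigma^r$ acting by $T_r\cdots T_1$ (every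 extension of $\xi$ arises this way). $\tilde\varphi_0$ is the character of $V_1\otimes\cdots\otimes V_r$ with $g\in G^{F^{rm}}$ acting diagonally and $\sigma$ acting by $x_1\otimes\cdots\otimes x_r\mapsto T_rx_r\otimes T_1x_1\otimes\cdots\otimes T_{r-1}x_{r-1}$. *)

theory Defs
  imports "HOL-Algebra.Group" "Jordan_Normal_Form.Matrix"
begin

text \<open>Abstract setting: a group G with a Frobenius endomorphism F, such that
 all fixed point groups of F^k (k>=1) are finite and Lang's theorem holds for F^k.\<close>

definition frob_setting :: "('a, 'b) monoid_scheme \<Rightarrow> ('a \<Rightarrow> 'a) \<Rightarrow> bool" where
  "frob_setting G F \<longleftrightarrow> group G \<and> F \<in> hom G G \<and> bij_betw F (carrier G) (carrier G) \<and>
     (\<forall>k\<ge>1. finite {g \<in> carrier G. (F ^^ k) g = g}) \<and>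
     (\<forall>k\<ge>1. \<forall>x\<in>carrier G. \<exists>\<alpha>\<in>carrier G. x = inv\<^bsub>G\<^esub> \<alpha> \<otimes>\<^bsub>G\<^esub> (F ^^ k) \<alpha>)"

definition fixpts :: "('a, 'b) monoid_scheme \<Rightarrow> ('a \<Rightarrow> 'a) \<Rightarrow> nat \<Rightarrow> 'a set" where
  "fixpts G F k = {g \<in> carrier G. (F ^^ k) g = g}"

text \<open>F^i(chi)(x) = chi(F^{-i}(x)) on H = G^{F^k} (F is bijective on H).\<close>
definition frob_char :: "('a \<Rightarrow> 'a) \<Rightarrow> 'a set \<Rightarrow> nat \<Rightarrow> ('a \<Rightarrow> complex) \<Rightarrow> 'a \<Rightarrow> complex" where
  "frob_char F H i \<chi> x = \<chi> (the_inv_into H (F ^^ i) x)"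

fun normr :: "('a, 'b) monoid_scheme \<Rightarrow> ('a \<Rightarrow> 'a) \<Rightarrow> nat \<Rightarrow> 'a \<Rightarrow> 'a" where
  "normr G F 0 x = \<one>\<^bsub>G\<^esub>"
| "normr G F (Suc k) x = normr G F k x \<otimes>\<^bsub>G\<^esub> (F ^^ k) x"

definition is_rep :: "('a, 'b) monoid_scheme \<Rightarrow> 'a set \<Rightarrow> nat \<Rightarrow> ('a \<Rightarrow> complex mat) \<Rightarrow> bool" where
  "is_rep G H n \<rho> \<longleftrightarrow> (\<forall>g\<in>H. \<rho> g \<in> carrier_mat n n) \<and> \<rho> \<one>\<^bsub>G\<^esub> = 1\<^sub>m n \<and>
     (\<forall>g\<in>H. \<forall>h\<in>H. \<rho> (g \<otimes>\<^bsub>G\<^esub> h) = \<rho> g * \<rho> h)"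

definition irreducible_rep :: "('a, 'b) monoid_scheme \<Rightarrow> 'a set \<Rightarrow> nat \<Rightarrow> ('a \<Rightarrow> complex mat) \<Rightarrow> bool" where
  "irreducible_rep G H n \<rho> \<longleftrightarrow> is_rep G H n \<rho> \<and> n > 0 \<and>
     (\<forall>W. W \<subseteq> carrier_vec n \<and> 0\<^sub>v n \<in> W \<and> (\<forall>v\<in>W. \<forall>w\<in>W. v + w \<in> W) \<and>
          (\<forall>c. \<forall>v\<in>W. c \<cdot>\<^sub>v v \<in> W) \<and> (\<forall>g\<in>H. \<forall>v\<in>W. \<rho> g *\<^sub>v v \<in> W)
        \<longrightarrow> W = {0\<^sub>v n} \<or> W = carrier_vec n)"

definition mat_trace :: "complex mat \<Rightarrow> complex" where
  "mat_trace A = (\<Sum>i<dim_row A. A $$ (i, i))"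

text \<open>Ordered product T (k-1) * ... * T 1 * T 0 (0-indexed version of T_r ... T_1).\<close>
fun mat_cprod :: "nat \<Rightarrow> (nat \<Rightarrow> complex mat) \<Rightarrow> nat \<Rightarrow> complex mat" where
  "mat_cprod n T 0 = 1\<^sub>m n"
| "mat_cprod n T (Suc k) = T k * mat_cprod n T k"

text \<open>Character of V_1 (rep rho 0) extended with sigma^r acting by T_r...T_1:
  value at x sigma^r.\<close>
definition xi_tilde_sr :: "nat \<Rightarrow> nat \<Rightarrow> (nat \<Rightarrow> 'a \<Rightarrow> complex mat) \<Rightarrow> (nat \<Rightarrow> complex mat) \<Rightarrow> 'a \<Rightarrow> complex" where
  "xi_tilde_sr n r \<rho> T x = mat_trace (\<rho> 0 x * mat_cprod n T r)"

text \<open>Character of V_1 (x) ... (x) V_r with x diagonal and sigma acting by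
  x_1 (x) ... (x) x_r |-> T_r x_r (x) T_1 x_1 (x) ... (x) T_{r-1} x_{r-1}, evaluated at x sigma.
  Written out in the standard tensor basis e_{k_0} (x) ... (x) e_{k_{r-1}} (0-indexed).\<close>
definition phi0_tilde_s :: "nat \<Rightarrow> nat \<Rightarrow> (nat \<Rightarrow> 'a \<Rightarrow> complex mat) \<Rightarrow> (nat \<Rightarrow> complex mat) \<Rightarrow> 'a \<Rightarrow> complex" where
  "phi0_tilde_s n r \<rho> T x =
     (\<Sum>k\<in>PiE {..<r} (\<lambda>_. {..<n}).
        \<Prod>i<r. (\<rho> i x * T ((i + r - 1) mod r)) $$ (k i, k ((i + r - 1) mod r)))"

definition shintani :: "('a, 'b) monoid_scheme \<Rightarrow> ('a \<Rightarrow> 'a) \<Rightarrow> nat \<Rightarrow> nat \<Rightarrow> ('a \<Rightarrow> complex) \<Rightarrow> 'a \<Rightarrow> complex" where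
  "shintani G F r m f y =
     (let \<alpha> = (SOME \<alpha>. \<alpha> \<in> carrier G \<and> y = (F ^^ (r * m)) \<alpha> \<otimes>\<^bsub>G\<^esub> inv\<^bsub>G\<^esub> \<alpha>)
      in f (inv\<^bsub>G\<^esub> \<alpha> \<otimes>\<^bsub>G\<^esub> (F ^^ r) \<alpha>))"

definition m_avg :: "('a, 'b) monoid_scheme \<Rightarrow> ('a \<Rightarrow> 'a) \<Rightarrow> ('a \<Rightarrow> complex) \<Rightarrow> complex" where
  "m_avg G F f = (\<Sum>x\<in>fixpts G F 1. f x) / of_nat (card (fixpts G F 1))"

definition M_avg :: "('a, 'b) monoid_scheme \<Rightarrow> ('a \<Rightarrow> 'a) \<Rightarrow> nat \<Rightarrow> ('a \<Rightarrow> complex) \<Rightarrow> complex" where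
  "M_avg G F k h = (\<Sum>x\<in>fixpts G F k. h x) / of_nat (card (fixpts G F k))"

end

theory Submission
  imports Defs "Jordan_Normal_Form.Spectral_Radius" "HOL-Algebra.Multiplicative_Group"
begin

text \<open>Lang's theorem makes both \<open>c\<close> and \<open>m\<^sub>r(R)\<close> averages of the same function over the finite set of
  \<open>\<alpha>\<close> with \<open>\<alpha>\<^sup>-\<^sup>1 F(\<alpha>)\<close> fixed by \<open>F\<^bsup>rm\<^esup>\<close>, and the trace of a cyclically rotated tensor product is the
  trace of the cyclic product of its factors, which turns \<open>\<phi>\<^sub>0(x\<sigma>)\<close> into \<open>\<xi>(N\<^sub>r(F x)\<sigma>\<^sup>r)\<close>.
  Averaging \<open>x\<sigma>\<close> over the group gives \<open>E S\<close>, where \<open>E\<close> projects onto the invariants of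
  \<open>V\<^sub>1 \<otimes> \<dots> \<otimes> V\<^sub>r\<close>, \<open>S\<close> is the action of \<open>\<sigma>\<close>, \<open>E\<close> and \<open>S\<close> commute, and \<open>S\<^bsup>rm\<^esup> = 1\<close>. So the
  nonzero eigenvalues of \<open>E S\<close> are \<open>rm\<close>-th roots of unity, and there are
  \<open>tr E = M(\<xi> F(\<xi>) \<cdots> F\<^bsup>r-1\<^esup>(\<xi>))\<close> of them. For \<open>r = 2\<close> this number is 1 or 0 by the orthogonality
  relations.\<close>

section \<open>Traces and averages of complex matrices\<close>

text \<open>The eigenvalue count needs no diagonalisation. As \<open>E\<close> is idempotent and
  commutes with \<open>S\<close>, (E S)^k = E S^k for k >= 1, so (E S)^(rm) = E and (E S)^(rm+1) = E
  S. After triangularising, every diagonal entry is 0 or an rm-th root of unity, and the trace of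
  the rm-th power counts the nonzero ones. The single inequality |tr(E S)| <= tr E gives both the
  bound in (i) and the vanishing in (ii). If tr E = 1, the one nonzero eigenvalue is the trace
  itself, whence the order rm = 2m in (ii). \<open>E\<close> and \<open>S\<close> commute because
  conjugation by \<sigma> is F, which permutes the finite group. For S^(rm) = 1 the powers of
  \<open>S\<close> are computed inside a family of tensor operators with arbitrary rotation, closed
  under products: S^r no longer rotates, and on each leg it is a cyclic rotation of T_r ... T_1. The
  F in N_r(F x) arises when the last T is carried once around the cycle; it disappears on summing
  over x. In (ii) two characters are multiplied without an inverse, so \<xi> is compared with the
  dual of F(\<xi>), and transposed matrices appear.\<close>

lemma mat_trace_mult_eq_sum:
  assumes "A \<in> carrier_mat n k" "B \<in> carrier_mat k n"
  shows "mat_trace (A * B) = (\<Sum>i<n. \<Sum>j<k. A $$ (i, j) * B $$ (j, i))"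
  using assms
  by (auto simp: mat_trace_def scalar_prod_def lessThan_atLeast0 intro!: sum.cong)

lemma mat_trace_mult_commute:
  assumes "A \<in> carrier_mat n k" "B \<in> carrier_mat k n"
  shows "mat_trace (A * B) = mat_trace (B * A)"
  unfolding mat_trace_mult_eq_sum[OF assms] mat_trace_mult_eq_sum[OF assms(2,1)]
  by (subst sum.swap) (simp add: mult.commute)

lemma mat_trace_conj:
  assumes "P \<in> carrier_mat n n" "A \<in> carrier_mat n n" "Q \<in> carrier_mat n n" "Q * P = 1\<^sub>m n"
  shows "mat_trace (P * A * Q) = mat_trace A"
proof -
  have "mat_trace (P * A * Q) = mat_trace (Q * (P * A))"
    by (rule mat_trace_mult_commute[of _ n n]) (use assms in auto)
  also have "Q * (P * A) = Q * P * A" using assms by (intro assoc_mult_mat[symmetric]) auto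
  finally show ?thesis using assms by simp
qed

section \<open>Triangular matrices and eigenvalues of periodic matrices\<close>

lemma upper_triangular_mult:
  fixes A B :: "'a :: semiring_0 mat"
  assumes A: "A \<in> carrier_mat n n" "upper_triangular A"
    and B: "B \<in> carrier_mat n n" "upper_triangular B"
  shows "upper_triangular (A * B)"
    and "i < n \<Longrightarrow> (A * B) $$ (i, i) = A $$ (i, i) * B $$ (i, i)"
proof -
  have ut: "A $$ (i, j) = 0" "B $$ (i, j) = 0" if "j < i" "i < n" for i j
    using that A B by (auto dest: upper_triangularD)
  have entry: "(A * B) $$ (i, j) = (\<Sum>l = 0..<n. A $$ (i, l) * B $$ (l, j))" if "i < n" "j < n" for i j
    using that A B by (simp add: scalar_prod_def)
  show "upper_triangular (A * B)"
  proof
    fix i j assume ij: "j < i" "i < dim_row (A * B)"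
    have "A $$ (i, l) * B $$ (l, j) = 0" if "l < n" for l
      using ut[of l i] ut[of j l] that ij A by (cases "l < i") auto
    then show "(A * B) $$ (i, j) = 0" using ij A by (subst entry) auto
  qed
  assume i: "i < n"
  have "(\<Sum>l = 0..<n. A $$ (i, l) * B $$ (l, i)) = (\<Sum>l\<in>{i}. A $$ (i, l) * B $$ (l, i))"
  proof (rule sum.mono_neutral_right)
    show "\<forall>l\<in>{0..<n} - {i}. A $$ (i, l) * B $$ (l, i) = 0"
      using ut i by (metis DiffE atLeastLessThan_iff insertI1 linorder_neqE_nat mult_zero_left mult_zero_right)
  qed (use i in auto)
  with i show "(A * B) $$ (i, i) = A $$ (i, i) * B $$ (i, i)" by (simp add: entry)
qed

lemma upper_triangular_pow:
  fixes A :: "'a :: comm_semiring_1 mat"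
  assumes A: "A \<in> carrier_mat n n" "upper_triangular A"
  shows "upper_triangular (A ^\<^sub>m k) \<and> (\<forall>i<n. (A ^\<^sub>m k) $$ (i, i) = (A $$ (i, i)) ^ k)"
proof (induction k)
  case (Suc k)
  then show ?case
    using upper_triangular_mult[of "A ^\<^sub>m k" n A] A by (auto simp: mult.commute)
qed (use A in auto)

text \<open>Over the complex numbers A is similar to an upper triangular B, and \<open>t\<close> is
  the diagonal of B. A coincidence between powers of A carries over to B, hence to each
  \<open>t i\<close>; this is how matrix identities become equations for single eigenvalues.\<close>

lemma mat_trace_pow_eq_power_sum:
  assumes A: "A \<in> carrier_mat n n"
  obtains t :: "nat \<Rightarrow> complex" where "\<And>k. mat_trace (A ^\<^sub>m k) = (\<Sum>i<n. t i ^ k)"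
    and "\<And>k l i. A ^\<^sub>m k = A ^\<^sub>m l \<Longrightarrow> i < n \<Longrightarrow> t i ^ k = t i ^ l"
proof -
  obtain es where "char_poly A = (\<Prod>a\<leftarrow>es. [:- a, 1:])" using char_poly_factorized[OF A] by blast
  then obtain B where B: "B \<in> carrier_mat n n" "upper_triangular B" "similar_mat A B"
    using schur_decomposition_exists[OF A] by blast
  then obtain P Q where wit: "similar_mat_wit A B P Q" unfolding similar_mat_def by blast
  note PQ = similar_mat_witD2[OF A wit]
  have Ak: "A ^\<^sub>m k = P * B ^\<^sub>m k * Q" for k using wit by (rule similar_mat_wit_pow_id)
  have Bk: "B ^\<^sub>m k = Q * A ^\<^sub>m k * P" for k
    using similar_mat_wit_sym[OF wit] by (rule similar_mat_wit_pow_id)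
  have diag: "(B ^\<^sub>m k) $$ (i, i) = (B $$ (i, i)) ^ k" if "i < n" for i k
    using upper_triangular_pow[OF B(1,2)] that by blast
  show thesis
  proof (rule that[of "\<lambda>i. B $$ (i, i)"])
    fix k
    have "mat_trace (A ^\<^sub>m k) = mat_trace (B ^\<^sub>m k)"
      unfolding Ak using PQ by (intro mat_trace_conj[of _ n]) auto
    also have "\<dots> = (\<Sum>i<n. (B $$ (i, i)) ^ k)"
      using B(1) diag by (auto simp: mat_trace_def)
    finally show "mat_trace (A ^\<^sub>m k) = (\<Sum>i<n. (B $$ (i, i)) ^ k)" .
  next
    fix k l i assume kl: "A ^\<^sub>m k = A ^\<^sub>m l" and i: "i < n"
    have "B ^\<^sub>m k = B ^\<^sub>m l" unfolding Bk kl ..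
    then show "(B $$ (i, i)) ^ k = (B $$ (i, i)) ^ l" using diag[OF i] by metis
  qed
qed

lemma cmod_root_of_unity:
  assumes "z ^ k = 1" "k > 0"
  shows "cmod z = 1"
proof -
  have "cmod z ^ k = 1 ^ k" using assms(1) by (simp flip: norm_power)
  then show ?thesis using assms(2) by (subst (asm) power_eq_iff_eq_base) auto
qed

text \<open>Each eigenvalue satisfies t^(N+1) = t, so it is 0 or an N-th root of unity. The trace of
  A^N is therefore the number of nonzero eigenvalues, while the trace of A is a sum of that many
  numbers of modulus 1.\<close>

lemma mat_trace_of_periodic:
  assumes A: "A \<in> carrier_mat n n" and N: "N > 0" and per: "A ^\<^sub>m Suc N = A"
  shows "cmod (mat_trace A) \<le> Re (mat_trace (A ^\<^sub>m N))"
    and "mat_trace (A ^\<^sub>m N) = 1 \<Longrightarrow> mat_trace A ^ N = 1"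
proof -
  obtain t where tr: "\<And>k. mat_trace (A ^\<^sub>m k) = (\<Sum>i<n. t i ^ k)"
    and eq: "\<And>k l i. A ^\<^sub>m k = A ^\<^sub>m l \<Longrightarrow> i < n \<Longrightarrow> t i ^ k = t i ^ l"
    using mat_trace_pow_eq_power_sum[OF A] by metis
  have A1: "A ^\<^sub>m 1 = A" using A by simp
  have t: "t i = 0 \<or> t i ^ N = 1" if "i < n" for i
  proof -
    have "t i ^ Suc N = t i ^ 1" using that per A1 by (intro eq) auto
    then show ?thesis by auto
  qed
  define Z where "Z = {i. i < n \<and> t i \<noteq> 0}"
  have [simp]: "finite Z" by (simp add: Z_def)
  have Zt: "t i ^ N = 1" if "i \<in> Z" for i using that t by (auto simp: Z_def)
  have trA: "mat_trace A = (\<Sum>i\<in>Z. t i)"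
    using tr[of 1] unfolding A1
    by (simp, intro sum.mono_neutral_right) (auto simp: Z_def)
  have "mat_trace (A ^\<^sub>m N) = (\<Sum>i\<in>Z. t i ^ N)"
    unfolding tr by (intro sum.mono_neutral_right) (use N in \<open>auto simp: Z_def\<close>)
  then have trN: "mat_trace (A ^\<^sub>m N) = of_nat (card Z)" using Zt by simp
  have "cmod (t i) = 1" if "i \<in> Z" for i
    using Zt[OF that] N by (rule cmod_root_of_unity)
  then have "cmod (\<Sum>i\<in>Z. t i) \<le> (\<Sum>i\<in>Z. 1)" by (intro order.trans[OF norm_sum] sum_mono) simp
  then show "cmod (mat_trace A) \<le> Re (mat_trace (A ^\<^sub>m N))" by (simp add: trA trN)
  assume "mat_trace (A ^\<^sub>m N) = 1"
  then have "card Z = 1" by (simp add: trN)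
  then obtain i where "Z = {i}" by (auto simp: card_1_singleton_iff)
  then show "mat_trace A ^ N = 1" using Zt by (simp add: trA)
qed

text \<open>A^k is the inverse of A, and the eigenvalues are roots of unity, whose inverses are
  their conjugates. This gives characters at inverse elements without introducing an invariant inner
  product.\<close>

lemma mat_trace_pow_pred_eq_cnj:
  assumes A: "A \<in> carrier_mat n n" and per: "A ^\<^sub>m Suc k = 1\<^sub>m n"
  shows "mat_trace (A ^\<^sub>m k) = cnj (mat_trace A)"
proof -
  obtain t where tr: "\<And>k. mat_trace (A ^\<^sub>m k) = (\<Sum>i<n. t i ^ k)"
    and eq: "\<And>k l i. A ^\<^sub>m k = A ^\<^sub>m l \<Longrightarrow> i < n \<Longrightarrow> t i ^ k = t i ^ l"
    using mat_trace_pow_eq_power_sum[OF A] by metis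
  have "t i ^ k = cnj (t i)" if "i < n" for i
  proof -
    have 1: "t i ^ Suc k = 1" using eq[of "Suc k" 0 i] that per A by simp
    then have "cmod (t i) = 1" by (rule cmod_root_of_unity) simp
    then have "t i * cnj (t i) = 1" by (simp add: complex_norm_square[symmetric])
    then show ?thesis using 1 by (metis mult.assoc mult.commute mult.right_neutral power_Suc)
  qed
  then have "(\<Sum>i<n. t i ^ k) = cnj (\<Sum>i<n. t i ^ 1)" by simp
  moreover have "A ^\<^sub>m 1 = A" using A by simp
  ultimately show ?thesis using tr by metis
qed

text \<open>The average is taken entry by entry, with the size \<open>d\<close> as an argument,
  since the zero matrix that an empty sum should give depends on the size.\<close>

definition mat_avg :: "'a set \<Rightarrow> nat \<Rightarrow> ('a \<Rightarrow> complex mat) \<Rightarrow> complex mat" where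
  "mat_avg H d f = mat d d (\<lambda>(i, j). (\<Sum>g\<in>H. f g $$ (i, j)) / of_nat (card H))"

lemma mat_avg_carrier [simp]: "mat_avg H d f \<in> carrier_mat d d"
  by (simp add: mat_avg_def)

lemma mat_avg_index:
  "i < d \<Longrightarrow> j < d \<Longrightarrow> mat_avg H d f $$ (i, j) = (\<Sum>g\<in>H. f g $$ (i, j)) / of_nat (card H)"
  by (simp add: mat_avg_def)

lemma mat_avg_cong: "(\<And>g. g \<in> H \<Longrightarrow> f g = f' g) \<Longrightarrow> mat_avg H d f = mat_avg H d f'"
  by (simp add: mat_avg_def cong: sum.cong)

lemma mat_avg_const:
  "finite H \<Longrightarrow> H \<noteq> {} \<Longrightarrow> A \<in> carrier_mat d d \<Longrightarrow> mat_avg H d (\<lambda>_. A) = A"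
  by (intro eq_matI) (auto simp: mat_avg_def)

lemma mat_avg_reindex:
  "bij_betw p H H \<Longrightarrow> mat_avg H d (\<lambda>g. f (p g)) = mat_avg H d f"
  unfolding mat_avg_def
  by (rule arg_cong[where f = "mat d d"], rule ext)
    (auto simp: sum.reindex_bij_betw[where g = "\<lambda>g. f g $$ (_, _)"])

lemma mat_avg_mult_right:
  assumes f: "\<And>g. g \<in> H \<Longrightarrow> f g \<in> carrier_mat d d" and A: "A \<in> carrier_mat d d"
  shows "mat_avg H d f * A = mat_avg H d (\<lambda>g. f g * A)"
proof (rule eq_matI)
  fix i j assume "i < dim_row (mat_avg H d (\<lambda>g. f g * A))" "j < dim_col (mat_avg H d (\<lambda>g. f g * A))"
  then have ij: "i < d" "j < d" by (auto simp: mat_avg_def)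
  have "(mat_avg H d f * A) $$ (i, j) = (\<Sum>l<d. (\<Sum>g\<in>H. f g $$ (i, l)) / of_nat (card H) * A $$ (l, j))"
    using ij A by (simp add: mat_avg_def scalar_prod_def lessThan_atLeast0)
  also have "\<dots> = (\<Sum>l<d. \<Sum>g\<in>H. f g $$ (i, l) * A $$ (l, j)) / of_nat (card H)"
    by (simp add: sum_divide_distrib sum_distrib_right)
  also have "\<dots> = (\<Sum>g\<in>H. \<Sum>l<d. f g $$ (i, l) * A $$ (l, j)) / of_nat (card H)"
    by (subst sum.swap) simp
  also have "\<dots> = (\<Sum>g\<in>H. (f g * A) $$ (i, j)) / of_nat (card H)"
    using ij A f by (auto simp: scalar_prod_def lessThan_atLeast0 intro!: sum.cong arg_cong2[where f = "(/)"]
        dest!: f)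
  finally show "(mat_avg H d f * A) $$ (i, j) = mat_avg H d (\<lambda>g. f g * A) $$ (i, j)"
    using ij by (simp add: mat_avg_index)
qed (use A in \<open>auto simp: mat_avg_def\<close>)

lemma mat_avg_mult_left:
  assumes f: "\<And>g. g \<in> H \<Longrightarrow> f g \<in> carrier_mat d d" and A: "A \<in> carrier_mat d d"
  shows "A * mat_avg H d f = mat_avg H d (\<lambda>g. A * f g)"
proof (rule eq_matI)
  fix i j assume "i < dim_row (mat_avg H d (\<lambda>g. A * f g))" "j < dim_col (mat_avg H d (\<lambda>g. A * f g))"
  then have ij: "i < d" "j < d" by (auto simp: mat_avg_def)
  have "(A * mat_avg H d f) $$ (i, j) = (\<Sum>l<d. A $$ (i, l) * ((\<Sum>g\<in>H. f g $$ (l, j)) / of_nat (card H)))"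
    using ij A by (simp add: mat_avg_def scalar_prod_def lessThan_atLeast0)
  also have "\<dots> = (\<Sum>l<d. \<Sum>g\<in>H. A $$ (i, l) * f g $$ (l, j)) / of_nat (card H)"
    by (simp add: sum_divide_distrib sum_distrib_left)
  also have "\<dots> = (\<Sum>g\<in>H. \<Sum>l<d. A $$ (i, l) * f g $$ (l, j)) / of_nat (card H)"
    by (subst sum.swap) simp
  also have "\<dots> = (\<Sum>g\<in>H. (A * f g) $$ (i, j)) / of_nat (card H)"
    using ij A f by (auto simp: scalar_prod_def lessThan_atLeast0 intro!: sum.cong arg_cong2[where f = "(/)"]
        dest!: f)
  finally show "(A * mat_avg H d f) $$ (i, j) = mat_avg H d (\<lambda>g. A * f g) $$ (i, j)"
    using ij by (simp add: mat_avg_index)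
qed (use A in \<open>auto simp: mat_avg_def\<close>)

lemma mat_trace_avg:
  assumes "\<And>g. g \<in> H \<Longrightarrow> f g \<in> carrier_mat d d"
  shows "mat_trace (mat_avg H d f) = (\<Sum>g\<in>H. mat_trace (f g)) / of_nat (card H)"
proof -
  have "mat_trace (mat_avg H d f) = (\<Sum>i<d. \<Sum>g\<in>H. f g $$ (i, i)) / of_nat (card H)"
    by (simp add: mat_trace_def mat_avg_def sum_divide_distrib)
  also have "\<dots> = (\<Sum>g\<in>H. mat_trace (f g)) / of_nat (card H)"
    unfolding mat_trace_def by (subst sum.swap) (use assms in \<open>force intro!: sum.cong arg_cong2[where f = "(/)"]\<close>)
  finally show ?thesis .
qed

section \<open>Orthogonality of characters\<close>

lemma inverse_of_surjective_mat:
  assumes A: "(A :: complex mat) \<in> carrier_mat n n"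
    and surj: "(\<lambda>v. A *\<^sub>v v) ` carrier_vec n = carrier_vec n"
  obtains B where "B \<in> carrier_mat n n" "A * B = 1\<^sub>m n" "B * A = 1\<^sub>m n"
proof -
  have "unit_vec n j \<in> (\<lambda>v. A *\<^sub>v v) ` carrier_vec n" for j
    unfolding surj by simp
  then have "\<forall>j. \<exists>v\<in>carrier_vec n. A *\<^sub>v v = unit_vec n j" by (metis imageE)
  then obtain b where b: "\<And>j. b j \<in> carrier_vec n" "\<And>j. A *\<^sub>v b j = unit_vec n j" by metis
  define B where "B = mat n n (\<lambda>(i, j). b j $ i)"
  have B: "B \<in> carrier_mat n n" by (simp add: B_def)
  have "A * B = 1\<^sub>m n"
  proof (rule eq_matI)
    fix i j assume ij: "i < dim_row (1\<^sub>m n)" "j < dim_col (1\<^sub>m n)"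
    have "(A * B) $$ (i, j) = (A *\<^sub>v col B j) $ i" using ij A B by simp
    also have "col B j = b j" using ij by (intro eq_vecI) (use b(1)[of j] in \<open>auto simp: B_def\<close>)
    finally show "(A * B) $$ (i, j) = 1\<^sub>m n $$ (i, j)" using ij b by auto
  qed (use A B in auto)
  with mat_mult_left_right_inverse[OF A B] that[OF B] show thesis by blast
qed

text \<open>The image of A is invariant under \<rho>, so it is zero or everything. As A is square,
  surjectivity already means invertibility, so the image decides both cases. In the application
  \<open>\<tau>\<close> is the family of transposes of a representation at inverse elements.\<close>

lemma schur_lemma:
  assumes irr: "irreducible_rep G H n \<rho>" and A: "A \<in> carrier_mat n n"
    and \<tau>: "\<And>h. h \<in> H \<Longrightarrow> \<tau> h \<in> carrier_mat n n"
    and intertw: "\<And>h. h \<in> H \<Longrightarrow> \<rho> h * A = A * \<tau> h"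
  shows "A = 0\<^sub>m n n \<or> (\<exists>B\<in>carrier_mat n n. A * B = 1\<^sub>m n \<and> B * A = 1\<^sub>m n)"
proof -
  let ?W = "(\<lambda>v. A *\<^sub>v v) ` carrier_vec n"
  have \<rho>: "\<rho> h \<in> carrier_mat n n" if "h \<in> H" for h
    using irr that by (auto simp: irreducible_rep_def is_rep_def)
  have W0: "0\<^sub>v n \<in> ?W" using A by (intro image_eqI[of _ _ "0\<^sub>v n"]) auto
  have Wadd: "v + w \<in> ?W" if vw: "v \<in> ?W" "w \<in> ?W" for v w
  proof -
    obtain v' w' where "v' \<in> carrier_vec n" "w' \<in> carrier_vec n" "v = A *\<^sub>v v'" "w = A *\<^sub>v w'"
      using vw by blast
    then show ?thesis
      using A by (intro image_eqI[of _ _ "v' + w'"]) (simp_all add: mult_add_distrib_mat_vec)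
  qed
  have Wsmult: "c \<cdot>\<^sub>v v \<in> ?W" if v: "v \<in> ?W" for c v
  proof -
    obtain v' where "v' \<in> carrier_vec n" "v = A *\<^sub>v v'" using v by blast
    then show ?thesis
      using A by (intro image_eqI[of _ _ "c \<cdot>\<^sub>v v'"]) (simp_all add: mult_mat_vec)
  qed
  have Winv: "\<rho> h *\<^sub>v w \<in> ?W" if h: "h \<in> H" and w: "w \<in> ?W" for h w
  proof -
    obtain v where v: "v \<in> carrier_vec n" "w = A *\<^sub>v v" using w by blast
    have "\<rho> h *\<^sub>v w = (\<rho> h * A) *\<^sub>v v" using v A \<rho>[OF h] by (simp add: assoc_mult_mat_vec)
    also have "\<dots> = A *\<^sub>v (\<tau> h *\<^sub>v v)"
      using v A \<tau>[OF h] by (simp add: intertw[OF h] assoc_mult_mat_vec)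
    finally show ?thesis using \<tau>[OF h] v by auto
  qed
  have "?W \<subseteq> carrier_vec n" using A by auto
  then have "?W = {0\<^sub>v n} \<or> ?W = carrier_vec n"
    using irr W0 Wadd Wsmult Winv unfolding irreducible_rep_def
    by (elim conjE allE[of _ ?W] impE) (intro conjI ballI allI; assumption)+
  then show ?thesis
  proof
    assume W: "?W = {0\<^sub>v n}"
    have "A = 0\<^sub>m n n"
    proof (rule eq_matI)
      fix i j assume ij: "i < dim_row (0\<^sub>m n n :: complex mat)" "j < dim_col (0\<^sub>m n n :: complex mat)"
      have "A *\<^sub>v unit_vec n j = 0\<^sub>v n" using W by auto
      then have "(A *\<^sub>v unit_vec n j) $ i = 0" using ij by simp
      then show "A $$ (i, j) = 0\<^sub>m n n $$ (i, j)" using ij A by simp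
    qed (use A in auto)
    then show ?thesis ..
  next
    assume "?W = carrier_vec n"
    then show ?thesis using inverse_of_surjective_mat[OF A] by blast
  qed
qed

text \<open>If c is an eigenvalue of A, then A - c also commutes with \<rho> but kills a nonzero
  vector. It cannot be invertible, so it is zero.\<close>

lemma schur_lemma_scalar:
  assumes irr: "irreducible_rep G H n \<rho>" and A: "A \<in> carrier_mat n n"
    and comm: "\<And>h. h \<in> H \<Longrightarrow> \<rho> h * A = A * \<rho> h"
  obtains c where "A = c \<cdot>\<^sub>m 1\<^sub>m n"
proof -
  have n: "n > 0" and \<rho>: "\<And>h. h \<in> H \<Longrightarrow> \<rho> h \<in> carrier_mat n n"
    using irr by (auto simp: irreducible_rep_def is_rep_def)
  obtain c where "eigenvalue A c" using spectrum_non_empty[OF A n] by (auto simp: spectrum_def)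
  then obtain v where v: "v \<in> carrier_vec n" "v \<noteq> 0\<^sub>v n" "char_matrix A c *\<^sub>v v = 0\<^sub>v n"
    unfolding eigenvalue_char_matrix[OF A] by blast
  let ?C = "char_matrix A c"
  have C: "?C \<in> carrier_mat n n" using A by simp
  have "\<rho> h * ?C = ?C * \<rho> h" if "h \<in> H" for h
    unfolding char_matrix_def using A \<rho>[OF that] comm[OF that]
    by (simp add: mult_add_distrib_mat[of _ n n _ n] add_mult_distrib_mat[of _ n n _ _ n]
        mult_smult_distrib[of _ n n _ n] mult_smult_assoc_mat[of _ n n _ n])
  from schur_lemma[OF irr C \<rho> this]
  have "?C = 0\<^sub>m n n"
  proof
    assume "\<exists>B\<in>carrier_mat n n. ?C * B = 1\<^sub>m n \<and> B * ?C = 1\<^sub>m n"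
    then obtain B where B: "B \<in> carrier_mat n n" "B * ?C = 1\<^sub>m n" by blast
    have "v = (B * ?C) *\<^sub>v v" using v B by simp
    also have "\<dots> = B *\<^sub>v (?C *\<^sub>v v)" using B(1) C v(1) by (rule assoc_mult_mat_vec)
    also have "\<dots> = 0\<^sub>v n" using B v by (intro eq_vecI) auto
    finally show ?thesis using v by simp
  qed
  have "A = c \<cdot>\<^sub>m 1\<^sub>m n"
  proof (rule eq_matI)
    fix i j assume ij: "i < dim_row (c \<cdot>\<^sub>m 1\<^sub>m n)" "j < dim_col (c \<cdot>\<^sub>m 1\<^sub>m n)"
    have "?C $$ (i, j) = 0" using \<open>?C = 0\<^sub>m n n\<close> ij by simp
    then show "A $$ (i, j) = (c \<cdot>\<^sub>m 1\<^sub>m n) $$ (i, j)" using ij A by (simp add: char_matrix_def split: if_splits)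
  qed (use A in auto)
  then show thesis by (rule that)
qed

lemma is_rep_carrier: "is_rep G H n \<rho> \<Longrightarrow> h \<in> H \<Longrightarrow> \<rho> h \<in> carrier_mat n n"
  and is_rep_mult: "is_rep G H n \<rho> \<Longrightarrow> g \<in> H \<Longrightarrow> h \<in> H \<Longrightarrow> \<rho> (g \<otimes>\<^bsub>G\<^esub> h) = \<rho> g * \<rho> h"
  and is_rep_one: "is_rep G H n \<rho> \<Longrightarrow> \<rho> \<one>\<^bsub>G\<^esub> = 1\<^sub>m n"
  by (auto simp: is_rep_def)

context group
begin

lemma subgroup_bij_mult_left:
  assumes "subgroup H G" "h \<in> H"
  shows "bij_betw (\<lambda>g. h \<otimes> g) H H"
proof (rule bij_betw_byWitness[where f' = "\<lambda>g. inv h \<otimes> g"])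
  have "g \<in> carrier G" if "g \<in> H" for g using assms(1) that by (rule subgroup.mem_carrier)
  then show "\<forall>g\<in>H. inv h \<otimes> (h \<otimes> g) = g" "\<forall>g\<in>H. h \<otimes> (inv h \<otimes> g) = g"
    using assms(2) by (auto simp: m_assoc[symmetric])
qed (use assms in \<open>auto simp: subgroup.m_closed subgroup.m_inv_closed\<close>)

lemma is_rep_inv:
  assumes "subgroup H G" "is_rep G H n \<rho>" "h \<in> H"
  shows "\<rho> h * \<rho> (inv h) = 1\<^sub>m n" "\<rho> (inv h) * \<rho> h = 1\<^sub>m n"
  using assms is_rep_mult[OF assms(2), of h "inv h"] is_rep_mult[OF assms(2), of "inv h" h]
  by (auto simp: is_rep_one subgroup.mem_carrier subgroup.m_inv_closed)

lemma is_rep_pow: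
  assumes "subgroup H G" "is_rep G H n \<rho>" "h \<in> H"
  shows "h [^] (k :: nat) \<in> H \<and> \<rho> (h [^] k) = \<rho> h ^\<^sub>m k"
proof (induction k)
  case 0
  then show ?case
    using is_rep_carrier[OF assms(2,3)] by (simp add: is_rep_one[OF assms(2)] subgroup.one_closed[OF assms(1)])
next
  case (Suc k)
  then show ?case using assms by (simp add: is_rep_mult subgroup.m_closed)
qed

text \<open>By Lagrange the inverse of h is h^(|H|-1), so \<rho>(h) has finite order and its inverse
  is a power of itself.\<close>

lemma char_inv_eq_cnj:
  assumes H: "subgroup H G" "finite H" and \<rho>: "is_rep G H n \<rho>" and h: "h \<in> H"
  shows "mat_trace (\<rho> (inv h)) = cnj (mat_trace (\<rho> h))"
proof -
  interpret K: group "G\<lparr>carrier := H\<rparr>" by (rule subgroup.subgroup_is_group[OF H(1) is_group])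
  have hc: "h \<in> carrier G" using H(1) h by (rule subgroup.mem_carrier)
  obtain k where k: "card H = Suc k" using H h by (metis card_eq_0_iff empty_iff not0_implies_Suc)
  have "h [^]\<^bsub>G\<lparr>carrier := H\<rparr>\<^esub> order (G\<lparr>carrier := H\<rparr>) = \<one>" using K.pow_order_eq_1[of h] h by simp
  then have pow: "h [^] Suc k = \<one>" by (simp add: order_def k nat_pow_consistent[symmetric])
  then have "h [^] k \<otimes> h = \<one>" by simp
  then have "inv h = h [^] k" using hc by (metis inv_equality nat_pow_closed)
  moreover have "\<rho> h ^\<^sub>m Suc k = 1\<^sub>m n"
    using is_rep_pow[OF H(1) \<rho> h, of "Suc k"] by (simp only: pow is_rep_one[OF \<rho>])
  ultimately show ?thesis
    using mat_trace_pow_pred_eq_cnj[of "\<rho> h" n k] is_rep_carrier[OF \<rho> h] is_rep_pow[OF H(1) \<rho> h] by simp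
qed

end

section \<open>Matrix units and the orthogonality relations\<close>

definition unit_mat :: "nat \<Rightarrow> nat \<Rightarrow> nat \<Rightarrow> complex mat" where
  "unit_mat n b d = mat n n (\<lambda>(i, j). if i = b \<and> j = d then 1 else 0)"

lemma unit_mat_carrier [simp]: "unit_mat n b d \<in> carrier_mat n n"
  by (simp add: unit_mat_def)

lemma mult_unit_mat_mult_index:
  assumes "A \<in> carrier_mat n n" "B \<in> carrier_mat n n" "a < n" "b < n" "c < n" "d < n"
  shows "(A * unit_mat n b d * B) $$ (a, c) = A $$ (a, b) * B $$ (d, c)"
proof -
  have entry: "(A * unit_mat n b d) $$ (a, j) = (if j = d then A $$ (a, b) else 0)" if "j < n" for j
    using assms that by (auto simp: unit_mat_def scalar_prod_def if_distrib if_distribR sum.delta cong: if_cong)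
  have "(A * unit_mat n b d * B) $$ (a, c)
      = (\<Sum>j = 0..<n. (A * unit_mat n b d) $$ (a, j) * B $$ (j, c))"
    using assms by (simp add: unit_mat_def scalar_prod_def)
  also have "\<dots> = (\<Sum>j = 0..<n. if j = d then A $$ (a, b) * B $$ (d, c) else 0)"
    by (intro sum.cong refl) (auto simp: entry)
  finally show ?thesis using assms by (simp add: sum.delta)
qed

lemma mat_trace_unit_mat: "b < n \<Longrightarrow> d < n \<Longrightarrow> mat_trace (unit_mat n b d) = (if b = d then 1 else 0)"
  by (auto simp: mat_trace_def unit_mat_def)

text \<open>A product of diagonal entries f(g)_aa f'(g)_cc is the (a, c) entry of f(g) E_ac f'(g),
  with E_ac a matrix unit. A sum of products of characters is thus read off from averaged operators,
  to which Schur's lemma applies.\<close>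

lemma sum_mat_trace_mult:
  assumes "\<And>g. g \<in> H \<Longrightarrow> f g \<in> carrier_mat n n" "\<And>g. g \<in> H \<Longrightarrow> f' g \<in> carrier_mat n n"
  shows "(\<Sum>g\<in>H. mat_trace (f g) * mat_trace (f' g)) / of_nat (card H)
    = (\<Sum>a<n. \<Sum>c<n. mat_avg H n (\<lambda>g. f g * unit_mat n a c * f' g) $$ (a, c))"
proof -
  have "(\<Sum>g\<in>H. mat_trace (f g) * mat_trace (f' g))
      = (\<Sum>g\<in>H. \<Sum>a<n. \<Sum>c<n. (f g * unit_mat n a c * f' g) $$ (a, c))"
  proof (rule sum.cong[OF refl])
    fix g assume "g \<in> H"
    note fg = assms[OF this]
    have "mat_trace (f g) * mat_trace (f' g) = (\<Sum>a<n. \<Sum>c<n. f g $$ (a, a) * f' g $$ (c, c))"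
      using fg by (simp add: mat_trace_def sum_product)
    then show "mat_trace (f g) * mat_trace (f' g) = (\<Sum>a<n. \<Sum>c<n. (f g * unit_mat n a c * f' g) $$ (a, c))"
      by (simp add: mult_unit_mat_mult_index[OF fg])
  qed
  also have "\<dots> = (\<Sum>a<n. \<Sum>g\<in>H. \<Sum>c<n. (f g * unit_mat n a c * f' g) $$ (a, c))"
    by (rule sum.swap)
  also have "\<dots> = (\<Sum>a<n. \<Sum>c<n. \<Sum>g\<in>H. (f g * unit_mat n a c * f' g) $$ (a, c))"
    by (intro sum.cong refl sum.swap)
  finally show ?thesis by (simp add: sum_divide_distrib mat_avg_index)
qed

context group
begin

text \<open>The condition \<open>ne\<close> says that \<rho> does not have the character of the dual
  of \<tau>. The average of \<rho>(g) X \<tau>(g)^T intertwines \<rho> with that dual, h |->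
  \<tau>(h^-1)^T; were it invertible the two characters would agree, so it vanishes for every
  X.\<close>

lemma char_orthogonality_distinct:
  assumes H: "subgroup H G" and irr: "irreducible_rep G H n \<rho>" and \<tau>: "is_rep G H n \<tau>"
    and ne: "\<exists>h\<in>H. mat_trace (\<rho> h) \<noteq> mat_trace (\<tau> (inv h))"
  shows "(\<Sum>g\<in>H. mat_trace (\<rho> g) * mat_trace (\<tau> g)) = 0"
proof -
  have \<rho>: "is_rep G H n \<rho>" using irr by (simp add: irreducible_rep_def)
  note c = is_rep_carrier[OF \<rho>] is_rep_carrier[OF \<tau>]
  have fin: "mat_avg H n (\<lambda>g. \<rho> g * X * (\<tau> g)\<^sup>T) = 0\<^sub>m n n" if X: "X \<in> carrier_mat n n" for X
  proof -
    define Y where "Y = mat_avg H n (\<lambda>g. \<rho> g * X * (\<tau> g)\<^sup>T)"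
    have Y: "Y \<in> carrier_mat n n" by (simp add: Y_def)
    have inv: "inv h \<in> H" if "h \<in> H" for h using subgroup.m_inv_closed[OF H that] .
    have intertw: "\<rho> h * Y = Y * (\<tau> (inv h))\<^sup>T" if h: "h \<in> H" for h
    proof -
      have "Y * (\<tau> (inv h))\<^sup>T = mat_avg H n (\<lambda>g. \<rho> g * X * (\<tau> g)\<^sup>T * (\<tau> (inv h))\<^sup>T)"
        unfolding Y_def using c X inv[OF h] by (intro mat_avg_mult_right) (auto intro!: mult_carrier_mat[of _ n n _ n])
      also have "\<dots> = mat_avg H n (\<lambda>g. \<rho> g * X * (\<tau> (inv h \<otimes> g))\<^sup>T)"
      proof (rule mat_avg_cong)
        fix g assume g: "g \<in> H"
        have "\<rho> g * X * (\<tau> g)\<^sup>T * (\<tau> (inv h))\<^sup>T = \<rho> g * X * ((\<tau> g)\<^sup>T * (\<tau> (inv h))\<^sup>T)"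
          using c[OF g] c[OF inv[OF h]] X by (intro assoc_mult_mat) auto
        also have "(\<tau> g)\<^sup>T * (\<tau> (inv h))\<^sup>T = (\<tau> (inv h \<otimes> g))\<^sup>T"
          using c[OF g] c[OF inv[OF h]] by (simp add: is_rep_mult[OF \<tau> inv[OF h] g] transpose_mult)
        finally show "\<rho> g * X * (\<tau> g)\<^sup>T * (\<tau> (inv h))\<^sup>T = \<rho> g * X * (\<tau> (inv h \<otimes> g))\<^sup>T" .
      qed
      \<comment> \<open>Replacing g by h g makes the argument of \<tau> collapse to g and brings out
        \<rho>(h) on the left.\<close>
      also have "\<dots> = mat_avg H n (\<lambda>g. \<rho> (h \<otimes> g) * X * (\<tau> (inv h \<otimes> (h \<otimes> g)))\<^sup>T)"
        by (rule mat_avg_reindex[OF subgroup_bij_mult_left[OF H h], symmetric])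
      also have "\<dots> = mat_avg H n (\<lambda>g. \<rho> h * (\<rho> g * X * (\<tau> g)\<^sup>T))"
      proof (rule mat_avg_cong)
        fix g assume g: "g \<in> H"
        have "inv h \<otimes> (h \<otimes> g) = g"
          using h g subgroup.mem_carrier[OF H] by (simp add: m_assoc[symmetric])
        then show "\<rho> (h \<otimes> g) * X * (\<tau> (inv h \<otimes> (h \<otimes> g)))\<^sup>T = \<rho> h * (\<rho> g * X * (\<tau> g)\<^sup>T)"
          using c[OF g] c[OF h] X
          by (simp add: is_rep_mult[OF \<rho> h g] assoc_mult_mat[of _ n n _ n _ n])
      qed
      also have "\<dots> = \<rho> h * Y"
        unfolding Y_def using c X h by (intro mat_avg_mult_left[symmetric]) (auto intro!: mult_carrier_mat[of _ n n _ n])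
      finally show ?thesis ..
    qed
    have "Y = 0\<^sub>m n n \<or> (\<exists>B\<in>carrier_mat n n. Y * B = 1\<^sub>m n \<and> B * Y = 1\<^sub>m n)"
      using c inv by (intro schur_lemma[OF irr Y _ intertw]) auto
    then show ?thesis
    proof
      assume "\<exists>B\<in>carrier_mat n n. Y * B = 1\<^sub>m n \<and> B * Y = 1\<^sub>m n"
      then obtain B where B: "B \<in> carrier_mat n n" "Y * B = 1\<^sub>m n" "B * Y = 1\<^sub>m n" by blast
      have "mat_trace (\<rho> h) = mat_trace (\<tau> (inv h))" if h: "h \<in> H" for h
      proof -
        have "\<rho> h = \<rho> h * Y * B" using c[OF h] Y B by (simp add: assoc_mult_mat[of _ n n _ n _ n])
        also have "\<dots> = Y * (\<tau> (inv h))\<^sup>T * B" by (simp add: intertw[OF h])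
        also have "mat_trace \<dots> = mat_trace ((\<tau> (inv h))\<^sup>T)"
          using c[OF inv[OF h]] Y B by (intro mat_trace_conj[of _ n]) auto
        also have "\<dots> = mat_trace (\<tau> (inv h))" using c[OF inv[OF h]] by (auto simp: mat_trace_def)
        finally show ?thesis .
      qed
      with ne show ?thesis by blast
    qed (simp add: Y_def)
  qed
  have "(\<Sum>g\<in>H. mat_trace (\<rho> g) * mat_trace ((\<tau> g)\<^sup>T)) / of_nat (card H) = 0"
    by (subst sum_mat_trace_mult[where n = n]) (use c in \<open>auto simp: fin\<close>)
  moreover have "mat_trace ((\<tau> g)\<^sup>T) = mat_trace (\<tau> g)" if "g \<in> H" for g
    using c[OF that] by (auto simp: mat_trace_def)
  \<comment> \<open>The quotient determines the sum only if \<open>card H\<close> is nonzero; in the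
    remaining cases the sum itself is 0 by convention.\<close>
  ultimately show ?thesis by (cases "finite H \<and> H \<noteq> {}") (auto simp: card_gt_0_iff)
qed

text \<open>The average of \<rho>(g) X \<rho>(g^-1) commutes with \<rho>, hence is scalar.
  Conjugation preserves the trace, so the scalar is tr(X)/n. Taking matrix units for X, only the n
  diagonal ones contribute, each 1/n.\<close>

lemma char_orthogonality_self:
  assumes H: "subgroup H G" "finite H" and irr: "irreducible_rep G H n \<rho>"
  shows "(\<Sum>g\<in>H. mat_trace (\<rho> g) * mat_trace (\<rho> (inv g))) / of_nat (card H) = 1"
proof -
  have \<rho>: "is_rep G H n \<rho>" and n: "n > 0" using irr by (auto simp: irreducible_rep_def)
  have inv: "inv h \<in> H" if "h \<in> H" for h using subgroup.m_inv_closed[OF H(1) that] .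
  have cH: "of_nat (card H) \<noteq> (0 :: complex)" using H subgroup.one_closed[OF H(1)] by auto
  note c = is_rep_carrier[OF \<rho>]
  have avg: "mat_avg H n (\<lambda>g. \<rho> g * X * \<rho> (inv g)) = (mat_trace X / of_nat n) \<cdot>\<^sub>m 1\<^sub>m n"
    if X: "X \<in> carrier_mat n n" for X
  proof -
    define Y where "Y = mat_avg H n (\<lambda>g. \<rho> g * X * \<rho> (inv g))"
    have Y: "Y \<in> carrier_mat n n" by (simp add: Y_def)
    have comm: "\<rho> h * Y = Y * \<rho> h" if h: "h \<in> H" for h
    proof -
      have "Y * \<rho> h = mat_avg H n (\<lambda>g. \<rho> g * X * \<rho> (inv g) * \<rho> h)"
        unfolding Y_def using c X inv h by (intro mat_avg_mult_right) (auto intro!: mult_carrier_mat[of _ n n _ n])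
      also have "\<dots> = mat_avg H n (\<lambda>g. \<rho> (h \<otimes> g) * X * \<rho> (inv (h \<otimes> g)) * \<rho> h)"
        by (rule mat_avg_reindex[OF subgroup_bij_mult_left[OF H(1) h], symmetric])
      also have "\<dots> = mat_avg H n (\<lambda>g. \<rho> h * (\<rho> g * X * \<rho> (inv g)))"
      proof (rule mat_avg_cong)
        fix g assume g: "g \<in> H"
        have "inv (h \<otimes> g) \<otimes> h = inv g"
          using h g subgroup.mem_carrier[OF H(1)] by (simp add: inv_mult_group m_assoc)
        then have "\<rho> (inv (h \<otimes> g)) * \<rho> h = \<rho> (inv g)"
          using is_rep_mult[OF \<rho>, of "inv (h \<otimes> g)" h] g h inv subgroup.m_closed[OF H(1)] by simp
        moreover have "\<rho> (inv (h \<otimes> g)) \<in> carrier_mat n n"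
          using c inv g h subgroup.m_closed[OF H(1)] by simp
        ultimately show "\<rho> (h \<otimes> g) * X * \<rho> (inv (h \<otimes> g)) * \<rho> h = \<rho> h * (\<rho> g * X * \<rho> (inv g))"
          using c[OF g] c[OF h] c[OF inv[OF g]] X
          by (simp add: is_rep_mult[OF \<rho> h g] assoc_mult_mat[of _ n n _ n _ n])
      qed
      also have "\<dots> = \<rho> h * Y"
        unfolding Y_def using c X h inv by (intro mat_avg_mult_left[symmetric]) (auto intro!: mult_carrier_mat[of _ n n _ n])
      finally show ?thesis ..
    qed
    obtain k where k: "Y = k \<cdot>\<^sub>m 1\<^sub>m n" using schur_lemma_scalar[OF irr Y comm] by blast
    have "mat_trace Y = (\<Sum>g\<in>H. mat_trace (\<rho> g * X * \<rho> (inv g))) / of_nat (card H)"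
      unfolding Y_def using c inv X by (intro mat_trace_avg) (auto intro!: mult_carrier_mat[of _ n n _ n])
    also have "(\<Sum>g\<in>H. mat_trace (\<rho> g * X * \<rho> (inv g))) = (\<Sum>g\<in>H. mat_trace X)"
      using c inv X is_rep_inv(2)[OF H(1) \<rho>] by (intro sum.cong refl mat_trace_conj[of _ n]) auto
    finally have "mat_trace Y = mat_trace X" using cH by simp
    moreover have "mat_trace Y = of_nat n * k" unfolding k by (simp add: mat_trace_def)
    ultimately have "k = mat_trace X / of_nat n" using n by (simp add: field_simps)
    with k show ?thesis by (simp add: Y_def)
  qed
  have "(\<Sum>g\<in>H. mat_trace (\<rho> g) * mat_trace (\<rho> (inv g))) / of_nat (card H)
      = (\<Sum>a<n. \<Sum>d<n. (mat_trace (unit_mat n a d) / of_nat n \<cdot>\<^sub>m 1\<^sub>m n) $$ (a, d))"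
    by (subst sum_mat_trace_mult[where n = n]) (use c inv in \<open>auto simp: avg\<close>)
  also have "\<dots> = (\<Sum>a<n. \<Sum>d<n. if a = d then 1 / of_nat n else 0)"
    by (intro sum.cong refl) (auto simp: mat_trace_unit_mat)
  also have "\<dots> = 1" using n by (simp add: sum.delta)
  finally show ?thesis .
qed

end

section \<open>Tensor products with rotated legs\<close>

definition tensor_index :: "nat \<Rightarrow> nat \<Rightarrow> (nat \<Rightarrow> nat) set" where
  "tensor_index r n = PiE {..<r} (\<lambda>_. {..<n})"

definition tensor_dim :: "nat \<Rightarrow> nat \<Rightarrow> nat" where
  "tensor_dim r n = card (tensor_index r n)"

text \<open>Matrices have numbers as indices, so the multi-indices of the tensor basis are listed in
  an arbitrary order. Only bijectivity is used; the traces do not depend on the choice.\<close>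

definition tensor_enum :: "nat \<Rightarrow> nat \<Rightarrow> nat \<Rightarrow> nat \<Rightarrow> nat" where
  "tensor_enum r n = (SOME h. bij_betw h {..<tensor_dim r n} (tensor_index r n))"

text \<open>The matrix in the tensor basis of the map sending \<open>x\<^sub>0 \<otimes> \<dots> \<otimes> x\<^bsub>r-1\<^esub>\<close> to the tensor whose
  \<open>i\<close>-th leg is \<open>A\<^sub>i x\<^bsub>i+s\<^esub>\<close>, indices modulo \<open>r\<close>; the rotation by \<open>\<sigma>\<close> is the case \<open>s = r - 1\<close>.\<close>

definition tensor_mat :: "nat \<Rightarrow> nat \<Rightarrow> nat \<Rightarrow> (nat \<Rightarrow> complex mat) \<Rightarrow> complex mat" where
  "tensor_mat r n s A = mat (tensor_dim r n) (tensor_dim r n)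
     (\<lambda>(a, b). \<Prod>i<r. A i $$ (tensor_enum r n a i, tensor_enum r n b ((i + s) mod r)))"

lemma finite_tensor_index [simp]: "finite (tensor_index r n)"
  by (auto simp: tensor_index_def intro!: finite_PiE)

lemma bij_tensor_enum: "bij_betw (tensor_enum r n) {..<tensor_dim r n} (tensor_index r n)"
  using someI_ex[OF ex_bij_betw_nat_finite[OF finite_tensor_index[of r n]]]
  by (simp add: tensor_enum_def tensor_dim_def lessThan_atLeast0)

lemma tensor_enum_mem: "a < tensor_dim r n \<Longrightarrow> tensor_enum r n a \<in> tensor_index r n"
  using bij_tensor_enum[of r n] by (auto simp: bij_betw_def)

lemma tensor_index_less: "k \<in> tensor_index r n \<Longrightarrow> i < r \<Longrightarrow> k i < n"
  by (auto simp: tensor_index_def)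

lemma tensor_mat_carrier [simp]: "tensor_mat r n s A \<in> carrier_mat (tensor_dim r n) (tensor_dim r n)"
  by (simp add: tensor_mat_def)

lemma tensor_mat_cong:
  assumes "\<And>i. i < r \<Longrightarrow> A i = B i" "s mod r = t mod r"
  shows "tensor_mat r n s A = tensor_mat r n t B"
proof -
  have "(i + s) mod r = (i + t) mod r" for i using assms(2) by (metis mod_add_right_eq)
  then show ?thesis using assms(1) by (simp add: tensor_mat_def)
qed

lemma bij_betw_shift_mod: "bij_betw (\<lambda>i. (i + s) mod r) {..<r} {..<r :: nat}"
proof -
  have "inj_on (\<lambda>i. (i + s) mod r) {..<r}"
  proof (rule inj_onI)
    fix i j assume *: "i \<in> {..<r}" "j \<in> {..<r}" "(i + s) mod r = (j + s) mod r"
    then have "(int i + int s) mod int r = (int j + int s) mod int r"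
      by (metis of_nat_add of_nat_mod)
    then have "int i mod int r = int j mod int r" by (metis add_diff_cancel_right' mod_diff_left_eq)
    with * show "i = j" by simp
  qed
  moreover have "(\<lambda>i. (i + s) mod r) ` {..<r} \<subseteq> {..<r}" by (cases "r = 0") auto
  ultimately show ?thesis by (simp add: bij_betw_def endo_inj_surj)
qed

text \<open>The summation index of the matrix product factors through the tensor legs once the first
  factor is reindexed along the rotation of the legs.\<close>

lemma tensor_mat_mult:
  assumes A: "\<And>i. i < r \<Longrightarrow> A i \<in> carrier_mat n n" and B: "\<And>i. i < r \<Longrightarrow> B i \<in> carrier_mat n n"
  shows "tensor_mat r n s A * tensor_mat r n t B
    = tensor_mat r n (s + t) (\<lambda>i. A i * B ((i + s) mod r))"
proof (rule eq_matI)
  let ?D = "tensor_dim r n" and ?e = "tensor_enum r n"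
  let ?R = "tensor_mat r n (s + t) (\<lambda>i. A i * B ((i + s) mod r))"
  define p where "p i = (i + s) mod r" for i
  have p: "bij_betw p {..<r} {..<r}" unfolding p_def by (rule bij_betw_shift_mod)
  define q where "q = the_inv_into {..<r} p"
  have qp: "q (p i) = i" if "i < r" for i
    using p that by (auto simp: q_def bij_betw_def the_inv_into_f_f)
  have plt: "p i < r" if "i < r" for i using that by (simp add: p_def)
  fix a b assume "a < dim_row ?R" "b < dim_col ?R"
  then have ab: "a < ?D" "b < ?D" by (auto simp: tensor_mat_def)
  let ?k = "?e a" and ?l = "?e b"
  have k: "?k i < n" "?l i < n" if "i < r" for i
    using ab that by (simp_all add: tensor_index_less[OF tensor_enum_mem])
  define f where "f j c = A (q j) $$ (?k (q j), c) * B j $$ (c, ?l ((j + t) mod r))" for j c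
  have "(tensor_mat r n s A * tensor_mat r n t B) $$ (a, b)
      = (\<Sum>c<?D. (\<Prod>i<r. A i $$ (?k i, ?e c (p i))) * (\<Prod>j<r. B j $$ (?e c j, ?l ((j + t) mod r))))"
    using ab by (simp add: tensor_mat_def scalar_prod_def lessThan_atLeast0 p_def)
  also have "\<dots> = (\<Sum>x\<in>tensor_index r n.
      (\<Prod>i<r. A i $$ (?k i, x (p i))) * (\<Prod>j<r. B j $$ (x j, ?l ((j + t) mod r))))"
    by (rule sum.reindex_bij_betw[OF bij_tensor_enum])
  also have "\<dots> = (\<Sum>x\<in>tensor_index r n. \<Prod>j<r. f j (x j))"
  proof (rule sum.cong[OF refl])
    fix x
    have "(\<Prod>i<r. A i $$ (?k i, x (p i))) = (\<Prod>i<r. A (q (p i)) $$ (?k (q (p i)), x (p i)))"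
      using qp by simp
    also have "\<dots> = (\<Prod>j<r. A (q j) $$ (?k (q j), x j))"
      by (rule prod.reindex_bij_betw[OF p])
    finally show "(\<Prod>i<r. A i $$ (?k i, x (p i))) * (\<Prod>j<r. B j $$ (x j, ?l ((j + t) mod r)))
        = (\<Prod>j<r. f j (x j))"
      by (simp add: f_def prod.distrib)
  qed
  \<comment> \<open>Distributivity: each coordinate of the multi-index \<open>x\<close> occurs in
    just one factor.\<close>
  also have "\<dots> = (\<Prod>j<r. \<Sum>c<n. f j c)"
    unfolding tensor_index_def by (rule prod_sum_PiE[symmetric]) auto
  also have "\<dots> = (\<Prod>i<r. \<Sum>c<n. f (p i) c)"
    by (rule prod.reindex_bij_betw[OF p, symmetric])
  also have "\<dots> = (\<Prod>i<r. (A i * B (p i)) $$ (?k i, ?l ((i + (s + t)) mod r)))"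
  proof (rule prod.cong[OF refl])
    fix i assume "i \<in> {..<r}"
    then have i: "i < r" by simp
    have "(p i + t) mod r = (i + (s + t)) mod r" by (simp add: p_def mod_simps add.assoc)
    moreover have "(i + (s + t)) mod r < r" using i by simp
    ultimately show "(\<Sum>c<n. f (p i) c) = (A i * B (p i)) $$ (?k i, ?l ((i + (s + t)) mod r))"
      using i k A[OF i] B[OF plt[OF i]]
      by (simp add: f_def qp scalar_prod_def lessThan_atLeast0)
  qed
  finally show "(tensor_mat r n s A * tensor_mat r n t B) $$ (a, b) = ?R $$ (a, b)"
    using ab by (simp add: tensor_mat_def p_def)
qed (auto simp: tensor_mat_def)

lemma tensor_mat_one: "tensor_mat r n 0 (\<lambda>_. 1\<^sub>m n) = 1\<^sub>m (tensor_dim r n)"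
proof (rule eq_matI)
  let ?e = "tensor_enum r n"
  fix a b assume "a < dim_row (1\<^sub>m (tensor_dim r n))" "b < dim_col (1\<^sub>m (tensor_dim r n))"
  then have ab: "a < tensor_dim r n" "b < tensor_dim r n" by auto
  have less: "?e a i < n" "?e b i < n" if "i < r" for i
    using ab that by (simp_all add: tensor_index_less[OF tensor_enum_mem])
  have entry: "tensor_mat r n 0 (\<lambda>_. 1\<^sub>m n) $$ (a, b) = (\<Prod>i<r. if ?e a i = ?e b i then 1 else 0)"
    using ab less by (simp add: tensor_mat_def)
  show "tensor_mat r n 0 (\<lambda>_. 1\<^sub>m n) $$ (a, b) = 1\<^sub>m (tensor_dim r n) $$ (a, b)"
  proof (cases "a = b")
    case True
    then show ?thesis using entry ab by simp
  next
    case False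
    then have "?e a \<noteq> ?e b" using bij_tensor_enum[of r n] ab by (auto simp: bij_betw_def inj_on_def)
    then obtain i where "i < r" "?e a i \<noteq> ?e b i"
      using PiE_ext[OF tensor_enum_mem[OF ab(1), unfolded tensor_index_def]
          tensor_enum_mem[OF ab(2), unfolded tensor_index_def]] by blast
    then have "(\<Prod>i<r. if ?e a i = ?e b i then 1 else 0 :: complex) = 0"
      by (intro prod_zero) auto
    then show ?thesis using entry ab False by simp
  qed
qed (auto simp: tensor_mat_def)

lemma mat_trace_tensor_mat:
  "mat_trace (tensor_mat r n s A) = (\<Sum>k\<in>tensor_index r n. \<Prod>i<r. A i $$ (k i, k ((i + s) mod r)))"
  using sum.reindex_bij_betw[OF bij_tensor_enum[of r n],
      of "\<lambda>k. \<Prod>i<r. A i $$ (k i, k ((i + s) mod r))"]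
  by (simp add: mat_trace_def tensor_mat_def)

lemma mat_trace_tensor_mat_0:
  assumes "\<And>i. i < r \<Longrightarrow> A i \<in> carrier_mat n n"
  shows "mat_trace (tensor_mat r n 0 A) = (\<Prod>i<r. mat_trace (A i))"
proof -
  have "(\<Prod>i<r. mat_trace (A i)) = (\<Prod>i<r. \<Sum>c<n. A i $$ (c, c))"
    using assms by (intro prod.cong refl) (force simp: mat_trace_def)
  also have "\<dots> = (\<Sum>k\<in>tensor_index r n. \<Prod>i<r. A i $$ (k i, k i))"
    unfolding tensor_index_def by (rule prod_sum_PiE) auto
  finally show ?thesis by (simp add: mat_trace_tensor_mat)
qed

lemma tensor_mat_pow:
  assumes "\<And>i. i < r \<Longrightarrow> A i \<in> carrier_mat n n"
  shows "tensor_mat r n 0 A ^\<^sub>m k = tensor_mat r n 0 (\<lambda>i. A i ^\<^sub>m k)"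
proof (induction k)
  case 0
  have "tensor_mat r n 0 (\<lambda>i. A i ^\<^sub>m 0) = tensor_mat r n 0 (\<lambda>_. 1\<^sub>m n)"
    using assms by (intro tensor_mat_cong) auto
  then show ?case by (simp add: tensor_mat_one) (simp add: tensor_mat_def)
next
  case (Suc k)
  have "tensor_mat r n 0 A ^\<^sub>m Suc k = tensor_mat r n (0 + 0) (\<lambda>i. A i ^\<^sub>m k * A ((i + 0) mod r))"
    unfolding pow_mat.simps Suc using assms by (intro tensor_mat_mult) auto
  also have "\<dots> = tensor_mat r n 0 (\<lambda>i. A i ^\<^sub>m Suc k)"
    by (intro tensor_mat_cong) auto
  finally show ?case .
qed

section \<open>Cyclic products as traces of rotated tensor products\<close>

lemma mat_cprod_carrier:
  assumes "\<And>i. i < k \<Longrightarrow> T i \<in> carrier_mat n n"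
  shows "mat_cprod n T k \<in> carrier_mat n n"
  using assms by (induction k) (auto intro!: mult_carrier_mat[of _ n n _ n])

lemma mat_cprod_cong:
  "(\<And>i. i < k \<Longrightarrow> T i = T' i) \<Longrightarrow> mat_cprod n T k = mat_cprod n T' k"
  by (induction k) auto

text \<open>The recursion adds factors on the left; peeling one off on the right as well is what
  allows a cyclic product to be rotated.\<close>

lemma mat_cprod_Suc_right:
  assumes "\<And>i. i \<le> k \<Longrightarrow> T i \<in> carrier_mat n n"
  shows "mat_cprod n T (Suc k) = mat_cprod n (\<lambda>i. T (Suc i)) k * T 0"
  using assms
proof (induction k)
  case 0
  have "T 0 \<in> carrier_mat n n" using 0 by simp
  then show ?case by simp
next
  case (Suc k)
  have "mat_cprod n (\<lambda>i. T (Suc i)) k \<in> carrier_mat n n" "T 0 \<in> carrier_mat n n"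
    "T (Suc k) \<in> carrier_mat n n"
    using Suc.prems by (auto intro!: mat_cprod_carrier)
  moreover have "mat_cprod n T (Suc k) = mat_cprod n (\<lambda>i. T (Suc i)) k * T 0"
    using Suc by simp
  ultimately show ?case
    by (subst mat_cprod.simps(2)) (simp add: assoc_mult_mat[of _ n n _ n _ n] del: mat_cprod.simps(2), simp)
qed

lemma sum_tensor_index_Suc:
  "(\<Sum>k\<in>tensor_index (Suc r) n. f k) = (\<Sum>a<n. \<Sum>k\<in>tensor_index r n. f (k(r := a)))"
proof -
  have "tensor_index (Suc r) n = (\<lambda>(a, k). k(r := a)) ` ({..<n} \<times> tensor_index r n)"
    unfolding tensor_index_def lessThan_Suc by (rule PiE_insert_eq)
  moreover have "inj_on (\<lambda>(a, k). k(r := a)) ({..<n} \<times> tensor_index r n)"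
    unfolding tensor_index_def by (rule inj_combinator) simp
  ultimately have "(\<Sum>k\<in>tensor_index (Suc r) n. f k)
      = (\<Sum>(a, k)\<in>{..<n} \<times> tensor_index r n. f (k(r := a)))"
    by (simp add: sum.reindex case_prod_unfold)
  then show ?thesis by (simp add: sum.cartesian_product)
qed

text \<open>An entry of the ordered product is a sum over paths b, k 0, ..., k (r - 1). The weight
  \<open>f\<close> at the end of the path is kept general so that the induction can absorb the next
  factor into it; the case r = 0 is the path that stays at b.\<close>

lemma sum_mat_cprod_index:
  assumes "\<And>i. i < r \<Longrightarrow> A i \<in> carrier_mat n n" "b < n"
  shows "(\<Sum>a<n. f a * mat_cprod n A r $$ (a, b)) = (\<Sum>k\<in>tensor_index r n.
    f (if r = 0 then b else k (r - 1)) * (\<Prod>i<r. A i $$ (k i, if i = 0 then b else k (i - 1))))"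
  using assms
proof (induction r arbitrary: f)
  case 0
  have "(\<Sum>a<n. f a * 1\<^sub>m n $$ (a, b)) = (\<Sum>a<n. if a = b then f b else 0)"
    using 0 by (intro sum.cong) auto
  then show ?case using 0 by (simp add: tensor_index_def)
next
  case (Suc r)
  let ?last = "\<lambda>k. if r = 0 then b else k (r - 1)"
  let ?w = "\<lambda>k. \<Prod>i<r. A i $$ (k i, if i = 0 then b else k (i - 1))"
  have A: "A r \<in> carrier_mat n n" and C: "mat_cprod n A r \<in> carrier_mat n n"
    using Suc.prems by (auto intro: mat_cprod_carrier)
  have "(\<Sum>a<n. f a * mat_cprod n A (Suc r) $$ (a, b))
      = (\<Sum>a<n. \<Sum>c<n. (f a * A r $$ (a, c)) * mat_cprod n A r $$ (c, b))"
    using A C \<open>b < n\<close> by (intro sum.cong refl)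
      (simp add: scalar_prod_def lessThan_atLeast0 sum_distrib_left mult.assoc)
  \<comment> \<open>The induction hypothesis is applied with the weight c |-> f a * A r (a,
    c).\<close>
  also have "\<dots> = (\<Sum>a<n. \<Sum>k\<in>tensor_index r n. (f a * A r $$ (a, ?last k)) * ?w k)"
    by (intro sum.cong refl Suc.IH) (use Suc.prems in auto)
  also have "\<dots> = (\<Sum>a<n. \<Sum>k\<in>tensor_index r n. f ((k(r := a)) r) *
      (\<Prod>i<Suc r. A i $$ ((k(r := a)) i, if i = 0 then b else (k(r := a)) (i - 1))))"
  proof (intro sum.cong refl)
    fix a k
    have "(\<Prod>i<r. A i $$ ((k(r := a)) i, if i = 0 then b else (k(r := a)) (i - 1))) = ?w k"
      by (intro prod.cong refl) auto
    then show "(f a * A r $$ (a, ?last k)) * ?w k = f ((k(r := a)) r) *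
      (\<Prod>i<Suc r. A i $$ ((k(r := a)) i, if i = 0 then b else (k(r := a)) (i - 1)))"
      unfolding prod.lessThan_Suc by auto
  qed
  also have "\<dots> = (\<Sum>k\<in>tensor_index (Suc r) n. f (k r) *
      (\<Prod>i<Suc r. A i $$ (k i, if i = 0 then b else k (i - 1))))"
    by (rule sum_tensor_index_Suc[symmetric])
  finally show ?case by simp
qed

text \<open>Modulo r, the shift r - 1 is a shift by -1, so factor i joins k (i - 1) to k i. The
  trace of the tensor operator is therefore the sum over closed paths of length r, which is also the
  trace of the product.\<close>

lemma mat_trace_rotated_tensor_mat:
  assumes A: "\<And>i. i < r \<Longrightarrow> A i \<in> carrier_mat n n" and r: "r > 0"
  shows "mat_trace (tensor_mat r n (r - 1) A) = mat_trace (mat_cprod n A r)"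
proof -
  let ?w = "\<lambda>b k. \<Prod>i<r. A i $$ (k i, if i = 0 then b else k (i - 1))"
  have "mat_trace (mat_cprod n A r) = (\<Sum>b<n. mat_cprod n A r $$ (b, b))"
    using mat_cprod_carrier[of r A n] A by (auto simp: mat_trace_def)
  \<comment> \<open>The indicator of a = b serves as the weight \<open>f\<close>; it forces the path
    to end where it started.\<close>
  also have "\<dots> = (\<Sum>b<n. \<Sum>a<n. (if a = b then 1 else 0) * mat_cprod n A r $$ (a, b))"
  proof (rule sum.cong[OF refl])
    fix b assume "b \<in> {..<n}"
    moreover have "(\<Sum>a<n. (if a = b then 1 else 0) * mat_cprod n A r $$ (a, b))
        = (\<Sum>a<n. if a = b then mat_cprod n A r $$ (a, b) else 0)"
      by (intro sum.cong) auto
    ultimately show "mat_cprod n A r $$ (b, b)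
        = (\<Sum>a<n. (if a = b then 1 else 0) * mat_cprod n A r $$ (a, b))"
      by (simp add: sum.delta)
  qed
  also have "\<dots> = (\<Sum>b<n. \<Sum>k\<in>tensor_index r n. (if k (r - 1) = b then 1 else 0) * ?w b k)"
  proof (rule sum.cong[OF refl])
    fix b assume "b \<in> {..<n}"
    then have "(\<Sum>a<n. (if a = b then 1 else 0) * mat_cprod n A r $$ (a, b)) = (\<Sum>k\<in>tensor_index r n.
        (if (if r = 0 then b else k (r - 1)) = b then 1 else 0) * ?w b k)"
      by (intro sum_mat_cprod_index A) simp_all
    also have "\<dots> = (\<Sum>k\<in>tensor_index r n. (if k (r - 1) = b then 1 else 0) * ?w b k)"
      using r by (simp only: if_False neq0_conv[symmetric])
    finally show "(\<Sum>a<n. (if a = b then 1 else 0) * mat_cprod n A r $$ (a, b))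
        = (\<Sum>k\<in>tensor_index r n. (if k (r - 1) = b then 1 else 0) * ?w b k)" .
  qed
  also have "\<dots> = (\<Sum>k\<in>tensor_index r n. \<Sum>b<n. (if k (r - 1) = b then 1 else 0) * ?w b k)"
    by (rule sum.swap)
  also have "\<dots> = (\<Sum>k\<in>tensor_index r n. ?w (k (r - 1)) k)"
  proof (rule sum.cong[OF refl])
    fix k assume "k \<in> tensor_index r n"
    then have "k (r - 1) < n" by (rule tensor_index_less) (use r in simp)
    moreover have "(\<Sum>b<n. (if k (r - 1) = b then 1 else 0) * ?w b k)
        = (\<Sum>b<n. if k (r - 1) = b then ?w b k else 0)"
      by (intro sum.cong) auto
    ultimately show "(\<Sum>b<n. (if k (r - 1) = b then 1 else 0) * ?w b k) = ?w (k (r - 1)) k"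
      by (simp add: sum.delta' del: One_nat_def)
  qed
  also have "\<dots> = (\<Sum>k\<in>tensor_index r n. \<Prod>i<r. A i $$ (k i, k ((i + (r - 1)) mod r)))"
  proof (intro sum.cong prod.cong refl)
    fix k :: "nat \<Rightarrow> nat" and i assume "i \<in> {..<r}"
    then have "(i + (r - 1)) mod r = (if i = 0 then r - 1 else i - 1)"
      using r by (cases i) (auto simp: mod_if)
    then show "A i $$ (k i, if i = 0 then k (r - 1) else k (i - 1)) = A i $$ (k i, k ((i + (r - 1)) mod r))"
      by simp
  qed
  finally show ?thesis by (simp add: mat_trace_tensor_mat)
qed

section \<open>Powers and finite order of the rotated operator\<close>

lemma pow_mat_pow_mat:
  fixes A :: "'a :: semiring_1 mat"
  assumes A: "A \<in> carrier_mat n n"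
  shows "(A ^\<^sub>m k) ^\<^sub>m l = A ^\<^sub>m (k * l)"
proof -
  interpret semiring "ring_mat TYPE('a) n ()" by (rule semiring_mat)
  have "(A ^\<^sub>m k) ^\<^sub>m l = (A ^\<^sub>m k) [^]\<^bsub>ring_mat TYPE('a) n ()\<^esub> l"
    using A by (intro pow_mat_ring_pow) simp
  then show ?thesis using A nat_pow_pow[of A k l]
    by (simp add: pow_mat_ring_pow[OF A, of _ "()"] ring_mat_simps)
qed

lemma pow_mat_Suc_left:
  fixes A :: "'a :: semiring_1 mat"
  assumes A: "A \<in> carrier_mat n n"
  shows "A ^\<^sub>m Suc k = A * A ^\<^sub>m k"
proof (induction k)
  case (Suc k)
  have "A ^\<^sub>m Suc (Suc k) = A * A ^\<^sub>m k * A" by (subst pow_mat.simps(2)) (simp only: Suc)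
  also have "\<dots> = A * A ^\<^sub>m Suc k" using A by (simp add: assoc_mult_mat[of _ n n _ n _ n])
  finally show ?case .
qed (use A in simp)

lemma pow_mat_intertwine:
  fixes A B P :: "'a :: semiring_1 mat"
  assumes c: "A \<in> carrier_mat n n" "B \<in> carrier_mat n n" "P \<in> carrier_mat n n"
    and eq: "B * P = P * A"
  shows "B ^\<^sub>m k * P = P * A ^\<^sub>m k"
proof (induction k)
  case (Suc k)
  have "B ^\<^sub>m Suc k * P = B ^\<^sub>m k * (B * P)" using c by (simp add: assoc_mult_mat[of _ n n _ n _ n])
  also have "\<dots> = B ^\<^sub>m k * P * A" using c by (simp add: eq assoc_mult_mat[of _ n n _ n _ n])
  also have "\<dots> = P * A ^\<^sub>m Suc k" using c by (simp add: Suc assoc_mult_mat[of _ n n _ n _ n])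
  finally show ?case .
qed (use c in simp)

text \<open>Neighbouring rotations C_i and C_(i+1) of the cyclic product satisfy C_(i+1) T_i = T_i
  C_i, both sides being the same product of r + 1 factors. As T_i is invertible, they are conjugate,
  and C^m = 1 passes from one to the next.\<close>

lemma mat_cprod_rotate_pow:
  assumes T: "\<And>i. i < r \<Longrightarrow> T i \<in> carrier_mat n n \<and> invertible_mat (T i)" and r: "r > 0"
    and order: "mat_cprod n T r ^\<^sub>m m = 1\<^sub>m n"
  shows "mat_cprod n (\<lambda>j. T ((i + j) mod r)) r ^\<^sub>m m = 1\<^sub>m n"
proof (induction i)
  case 0
  have "mat_cprod n (\<lambda>j. T ((0 + j) mod r)) r = mat_cprod n T r" by (rule mat_cprod_cong) simp
  then show ?case using order by simp
next
  case (Suc i)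
  let ?C = "\<lambda>i. mat_cprod n (\<lambda>j. T ((i + j) mod r)) r" and ?P = "T (i mod r)"
  have Tc: "T (j mod r) \<in> carrier_mat n n" for j using T[of "j mod r"] r by simp
  have C: "?C i \<in> carrier_mat n n" for i using Tc by (intro mat_cprod_carrier)
  have "?C (Suc i) * ?P = mat_cprod n (\<lambda>j. T ((i + j) mod r)) (Suc r)"
    using Tc by (subst mat_cprod_Suc_right) auto
  then have "?C (Suc i) * ?P = ?P * ?C i" by simp
  with Tc C have "?C (Suc i) ^\<^sub>m m * ?P = ?P * ?C i ^\<^sub>m m" by (intro pow_mat_intertwine)
  then have eq: "?C (Suc i) ^\<^sub>m m * ?P = ?P" using Tc[of i] by (simp add: Suc)
  obtain Q where Q: "inverts_mat ?P Q" "inverts_mat Q ?P"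
    using T[of "i mod r"] r by (auto simp: invertible_mat_def)
  then have PQ: "?P * Q = 1\<^sub>m n" and "Q * ?P = 1\<^sub>m (dim_row Q)"
    using Tc[of i] by (auto simp: inverts_mat_def)
  then have Qc: "Q \<in> carrier_mat n n"
    using Tc[of i] by (metis carrier_matD(2) carrier_matI index_mult_mat(3) index_one_mat(3))
  have "?C (Suc i) ^\<^sub>m m = ?C (Suc i) ^\<^sub>m m * (?P * Q)" using C[of "Suc i"] by (simp add: PQ)
  also have "\<dots> = ?C (Suc i) ^\<^sub>m m * ?P * Q"
    using C[of "Suc i"] Tc Qc by (intro assoc_mult_mat[symmetric]) auto
  also have "\<dots> = 1\<^sub>m n" by (simp only: eq PQ)
  finally show ?case .
qed

text \<open>After k steps leg i carries T_(i-1) ... T_(i-k), indices modulo r. Writing -k as k * (r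
  - 1) avoids subtraction of natural numbers.\<close>

lemma rotated_tensor_mat_pow:
  assumes T: "\<And>i. i < r \<Longrightarrow> T i \<in> carrier_mat n n" and r: "r > 0"
  shows "tensor_mat r n (r - 1) (\<lambda>i. T ((i + r - 1) mod r)) ^\<^sub>m k
    = tensor_mat r n (k * (r - 1)) (\<lambda>i. mat_cprod n (\<lambda>j. T ((i + k * (r - 1) + j) mod r)) k)"
proof (induction k)
  case 0
  then show ?case by (simp add: tensor_mat_one) (simp add: tensor_mat_def)
next
  case (Suc k)
  have Tc: "T (j mod r) \<in> carrier_mat n n" for j using T[of "j mod r"] r by simp
  let ?S = "tensor_mat r n (r - 1) (\<lambda>i. T ((i + r - 1) mod r))"
  have "?S ^\<^sub>m Suc k = ?S * ?S ^\<^sub>m k" by (rule pow_mat_Suc_left[OF tensor_mat_carrier])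
  also have "\<dots> = tensor_mat r n (r - 1 + k * (r - 1)) (\<lambda>i. T ((i + r - 1) mod r) *
      mat_cprod n (\<lambda>j. T (((i + (r - 1)) mod r + k * (r - 1) + j) mod r)) k)"
    unfolding Suc using Tc by (intro tensor_mat_mult mat_cprod_carrier) auto
  also have "\<dots> = tensor_mat r n (Suc k * (r - 1))
      (\<lambda>i. mat_cprod n (\<lambda>j. T ((i + Suc k * (r - 1) + j) mod r)) (Suc k))"
  proof (rule tensor_mat_cong)
    fix i
    \<comment> \<open>This index belongs to the new leftmost factor: modulo r it is i - 1.\<close>
    have "i + Suc k * (r - 1) + k = i + r - 1 + k * r"
      using r by (cases r) (auto simp: algebra_simps)
    then have "(i + Suc k * (r - 1) + k) mod r = (i + r - 1) mod r" by simp
    moreover have "((i + (r - 1)) mod r + k * (r - 1) + j) mod r = (i + Suc k * (r - 1) + j) mod r" for j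
      by (simp add: mod_simps add.assoc)
    ultimately show "T ((i + r - 1) mod r) *
        mat_cprod n (\<lambda>j. T (((i + (r - 1)) mod r + k * (r - 1) + j) mod r)) k
      = mat_cprod n (\<lambda>j. T ((i + Suc k * (r - 1) + j) mod r)) (Suc k)" by simp
  qed simp
  finally show ?case .
qed

text \<open>After r steps the total shift r * (r - 1) is 0 modulo r. Each leg then carries a cyclic
  rotation of the full product of the T's, whose m-th power is 1.\<close>

lemma rotated_tensor_mat_order:
  assumes T: "\<And>i. i < r \<Longrightarrow> T i \<in> carrier_mat n n \<and> invertible_mat (T i)" and r: "r > 0"
    and order: "mat_cprod n T r ^\<^sub>m m = 1\<^sub>m n"
  shows "tensor_mat r n (r - 1) (\<lambda>i. T ((i + r - 1) mod r)) ^\<^sub>m (r * m) = 1\<^sub>m (tensor_dim r n)"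
proof -
  let ?S = "tensor_mat r n (r - 1) (\<lambda>i. T ((i + r - 1) mod r))"
  let ?C = "\<lambda>i. mat_cprod n (\<lambda>j. T ((i + r * (r - 1) + j) mod r)) r"
  have Tc: "T (j mod r) \<in> carrier_mat n n" for j using T[of "j mod r"] r by simp
  have "?S ^\<^sub>m r = tensor_mat r n (r * (r - 1)) ?C"
    by (rule rotated_tensor_mat_pow) (use T r in auto)
  also have "\<dots> = tensor_mat r n 0 ?C" by (rule tensor_mat_cong) auto
  finally have Sr: "?S ^\<^sub>m r = tensor_mat r n 0 ?C" .
  have "?S ^\<^sub>m (r * m) = (?S ^\<^sub>m r) ^\<^sub>m m" by (rule pow_mat_pow_mat[OF tensor_mat_carrier, symmetric])
  also have "\<dots> = tensor_mat r n 0 (\<lambda>i. ?C i ^\<^sub>m m)"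
    unfolding Sr using Tc by (intro tensor_mat_pow mat_cprod_carrier)
  also have "\<dots> = tensor_mat r n 0 (\<lambda>_. 1\<^sub>m n)"
    using mat_cprod_rotate_pow[OF T r order] by (intro tensor_mat_cong) auto
  finally show ?thesis by (simp add: tensor_mat_one)
qed

text \<open>(E S)^k = E S^k holds from k = 1 on; for k = 0 the left side is 1 instead of E. This is
  why the induction runs over \<open>Suc k\<close> and N must be positive.\<close>

lemma idempotent_mult_finite_order:
  fixes E S :: "'a :: semiring_1 mat"
  assumes c: "E \<in> carrier_mat d d" "S \<in> carrier_mat d d"
    and idem: "E * E = E" and comm: "E * S = S * E" and order: "S ^\<^sub>m N = 1\<^sub>m d" and N: "N > 0"
  shows "(E * S) ^\<^sub>m N = E" "(E * S) ^\<^sub>m Suc N = E * S"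
proof -
  have pow: "(E * S) ^\<^sub>m Suc k = E * S ^\<^sub>m Suc k" for k
  proof (induction k)
    case 0
    then show ?case using c by simp
  next
    case (Suc k)
    have "(E * S) ^\<^sub>m Suc (Suc k) = E * S ^\<^sub>m Suc k * (E * S)" by (subst pow_mat.simps(2)) (simp only: Suc)
    also have "\<dots> = E * (S ^\<^sub>m Suc k * E) * S"
      using c by (simp add: assoc_mult_mat[of _ d d _ d _ d] mult_carrier_mat[of _ d d _ d] del: pow_mat.simps)
    also have "S ^\<^sub>m Suc k * E = E * S ^\<^sub>m Suc k"
      using c comm by (intro pow_mat_intertwine) auto
    also have "E * (E * S ^\<^sub>m Suc k) * S = E * E * (S ^\<^sub>m Suc k * S)"
      using c by (simp add: assoc_mult_mat[of _ d d _ d _ d] mult_carrier_mat[of _ d d _ d] del: pow_mat.simps)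
    finally show ?case by (simp add: idem)
  qed
  show EN: "(E * S) ^\<^sub>m N = E" using pow[of "N - 1"] N c order by simp
  show "(E * S) ^\<^sub>m Suc N = E * S"
    using c by (simp add: EN idem flip: assoc_mult_mat[of _ d d _ d _ d])
qed

section \<open>Groups with a Frobenius map\<close>

locale frobenius_group = group G for G (structure) +
  fixes F :: "'a \<Rightarrow> 'a"
  assumes setting: "frob_setting G F"
begin

lemma F_hom: "F \<in> hom G G"
  and F_bij: "bij_betw F (carrier G) (carrier G)"
  and finite_fixpts: "k \<ge> 1 \<Longrightarrow> finite (fixpts G F k)"
  and lang: "k \<ge> 1 \<Longrightarrow> x \<in> carrier G \<Longrightarrow> \<exists>\<alpha>\<in>carrier G. x = inv \<alpha> \<otimes> (F ^^ k) \<alpha>"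
  using setting by (auto simp: frob_setting_def fixpts_def)

lemma Fpow_hom: "F ^^ k \<in> hom G G"
proof (induction k)
  case (Suc k)
  then show ?case using F_hom by (auto simp: hom_def Pi_def)
qed (auto simp: hom_def)

lemma Fpow_closed [simp]: "x \<in> carrier G \<Longrightarrow> (F ^^ k) x \<in> carrier G"
  using hom_in_carrier[OF Fpow_hom] .

lemma Fpow_mult: "x \<in> carrier G \<Longrightarrow> y \<in> carrier G \<Longrightarrow> (F ^^ k) (x \<otimes> y) = (F ^^ k) x \<otimes> (F ^^ k) y"
  using hom_mult[OF Fpow_hom] .

lemma Fpow_inv: "x \<in> carrier G \<Longrightarrow> (F ^^ k) (inv x) = inv ((F ^^ k) x)"
  using group_hom.hom_inv[of G G "F ^^ k" x] Fpow_hom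
  by (simp add: group_hom_def group_hom_axioms_def is_group)

lemma Fpow_one [simp]: "(F ^^ k) \<one> = \<one>"
  using hom_one[OF Fpow_hom is_group is_group] .

lemmas F_closed [simp] = Fpow_closed[of _ 1, simplified]
  and F_mult = Fpow_mult[of _ _ 1, simplified]
  and F_inv = Fpow_inv[of _ 1, simplified]
  and F_one [simp] = Fpow_one[of 1, simplified]

lemma Fpow_F: "(F ^^ k) (F x) = F ((F ^^ k) x)"
  by (simp add: funpow_swap1)

lemma fixpts_subgroup: "subgroup (fixpts G F k) G"
  by (rule subgroupI) (auto simp: fixpts_def Fpow_mult Fpow_inv)

lemma fixpts_closed: "x \<in> fixpts G F k \<Longrightarrow> x \<in> carrier G"
  by (simp add: fixpts_def)

lemma F_fixpts: "x \<in> fixpts G F k \<Longrightarrow> F x \<in> fixpts G F k"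
  by (auto simp: fixpts_def Fpow_F)

lemma Fpow_fixpts: "x \<in> fixpts G F k \<Longrightarrow> (F ^^ l) x \<in> fixpts G F k"
  by (induction l) (auto intro: F_fixpts)

lemma F_bij_fixpts:
  assumes "k \<ge> 1"
  shows "bij_betw F (fixpts G F k) (fixpts G F k)"
proof -
  have "inj_on F (fixpts G F k)"
    using F_bij by (auto simp: bij_betw_def fixpts_def intro: inj_on_subset)
  moreover have "F ` fixpts G F k \<subseteq> fixpts G F k" using F_fixpts by auto
  ultimately show ?thesis using finite_fixpts[OF assms] by (simp add: bij_betw_def endo_inj_surj)
qed

lemma normr_fixpts: "x \<in> fixpts G F k \<Longrightarrow> normr G F l x \<in> fixpts G F k"
  by (induction l)
    (auto intro: subgroup.one_closed[OF fixpts_subgroup] subgroup.m_closed[OF fixpts_subgroup] Fpow_fixpts)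

lemma normr_closed [simp]: "x \<in> carrier G \<Longrightarrow> normr G F l x \<in> carrier G"
  by (induction l) auto

lemma normr_F: "x \<in> carrier G \<Longrightarrow> normr G F l (F x) = F (normr G F l x)"
  by (induction l) (auto simp: F_mult Fpow_F)

text \<open>The definition appends F^l(x) on the right; when intertwiners are moved past the
  modules, the norm grows on the left.\<close>

lemma normr_Suc_left:
  assumes x: "x \<in> carrier G"
  shows "normr G F (Suc l) x = x \<otimes> F (normr G F l x)"
proof (induction l)
  case (Suc l)
  have "normr G F (Suc (Suc l)) x = x \<otimes> F (normr G F l x) \<otimes> F ((F ^^ l) x)"
    by (subst normr.simps(2)) (simp only: Suc funpow.simps comp_apply)
  also have "\<dots> = x \<otimes> F (normr G F (Suc l) x)" using x by (simp add: F_mult m_assoc)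
  finally show ?case .
qed (use x in simp)

text \<open>With u = \<alpha>^-1 F(\<alpha>), the factor F^i(u) is F^i(\<alpha>)^-1
  F^(i+1)(\<alpha>), so the product telescopes.\<close>

lemma normr_lang:
  assumes "\<alpha> \<in> carrier G"
  shows "normr G F l (inv \<alpha> \<otimes> F \<alpha>) = inv \<alpha> \<otimes> (F ^^ l) \<alpha>"
proof (induction l)
  case (Suc l)
  have "normr G F (Suc l) (inv \<alpha> \<otimes> F \<alpha>)
      = inv \<alpha> \<otimes> (F ^^ l) \<alpha> \<otimes> (inv ((F ^^ l) \<alpha>) \<otimes> (F ^^ Suc l) \<alpha>)"
    using assms by (simp add: Suc Fpow_mult Fpow_inv Fpow_F)
  also have "\<dots> = inv \<alpha> \<otimes> ((F ^^ l) \<alpha> \<otimes> inv ((F ^^ l) \<alpha>)) \<otimes> (F ^^ Suc l) \<alpha>"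
    using assms by (simp only: m_assoc m_closed inv_closed Fpow_closed)
  finally show ?case using assms by simp
qed (use assms in simp)

section \<open>Fibres of the two Lang maps and Shintani descent\<close>

text \<open>If F^N(\<alpha>) = y \<alpha>, then applying F^N to \<alpha>^-1 F(\<alpha>) inserts y^-1
  F(y) in the middle. The element is fixed exactly when this insertion is trivial.\<close>

lemma lang_fixpts_iff:
  assumes a: "\<alpha> \<in> carrier G"
  shows "inv \<alpha> \<otimes> F \<alpha> \<in> fixpts G F N \<longleftrightarrow> (F ^^ N) \<alpha> \<otimes> inv \<alpha> \<in> fixpts G F 1"
proof -
  define y where "y = (F ^^ N) \<alpha> \<otimes> inv \<alpha>"
  have y: "y \<in> carrier G" using a by (simp add: y_def)
  have Na: "(F ^^ N) \<alpha> = y \<otimes> \<alpha>" using a by (simp add: y_def m_assoc)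
  have "(F ^^ N) (inv \<alpha> \<otimes> F \<alpha>) = inv (y \<otimes> \<alpha>) \<otimes> F (y \<otimes> \<alpha>)"
    using a by (simp add: Fpow_mult Fpow_inv Fpow_F Na)
  also have "\<dots> = inv \<alpha> \<otimes> (inv y \<otimes> F y \<otimes> F \<alpha>)"
    using a y by (simp add: F_mult inv_mult_group m_assoc)
  finally have "inv \<alpha> \<otimes> F \<alpha> \<in> fixpts G F N \<longleftrightarrow> inv \<alpha> \<otimes> (inv y \<otimes> F y \<otimes> F \<alpha>) = inv \<alpha> \<otimes> F \<alpha>"
    using a by (simp add: fixpts_def)
  also have "\<dots> \<longleftrightarrow> inv y \<otimes> F y \<otimes> F \<alpha> = \<one> \<otimes> F \<alpha>" using a y by simp
  also have "\<dots> \<longleftrightarrow> inv y \<otimes> F y = \<one>" using a y by (intro right_cancel) auto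
  also have "\<dots> \<longleftrightarrow> F y = y"
    using y by (metis F_closed inv_closed inv_equality inv_inv l_inv inv_comm)
  finally show ?thesis using y by (simp add: fixpts_def y_def)
qed

lemma lang_fibre:
  assumes a: "\<alpha>\<^sub>0 \<in> carrier G"
  shows "{\<alpha> \<in> carrier G. inv \<alpha> \<otimes> F \<alpha> = inv \<alpha>\<^sub>0 \<otimes> F \<alpha>\<^sub>0} = (\<lambda>s. s \<otimes> \<alpha>\<^sub>0) ` fixpts G F 1"
proof (intro equalityI subsetI)
  fix \<alpha> assume "\<alpha> \<in> {\<alpha> \<in> carrier G. inv \<alpha> \<otimes> F \<alpha> = inv \<alpha>\<^sub>0 \<otimes> F \<alpha>\<^sub>0}"
  then have \<alpha>: "\<alpha> \<in> carrier G" and eq: "inv \<alpha> \<otimes> F \<alpha> = inv \<alpha>\<^sub>0 \<otimes> F \<alpha>\<^sub>0" by auto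
  have "F (\<alpha> \<otimes> inv \<alpha>\<^sub>0) = \<alpha> \<otimes> (inv \<alpha> \<otimes> F \<alpha>) \<otimes> inv (F \<alpha>\<^sub>0)"
    using \<alpha> a by (simp add: F_mult F_inv m_assoc[symmetric])
  also have "\<dots> = \<alpha> \<otimes> inv \<alpha>\<^sub>0" unfolding eq using \<alpha> a by (simp add: m_assoc)
  finally have "\<alpha> \<otimes> inv \<alpha>\<^sub>0 \<in> fixpts G F 1" using \<alpha> a by (simp add: fixpts_def)
  moreover have "\<alpha> = \<alpha> \<otimes> inv \<alpha>\<^sub>0 \<otimes> \<alpha>\<^sub>0" using \<alpha> a by (simp add: m_assoc)
  ultimately show "\<alpha> \<in> (\<lambda>s. s \<otimes> \<alpha>\<^sub>0) ` fixpts G F 1" by blast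
next
  fix \<alpha> assume "\<alpha> \<in> (\<lambda>s. s \<otimes> \<alpha>\<^sub>0) ` fixpts G F 1"
  then obtain s where s: "s \<in> carrier G" "F s = s" "\<alpha> = s \<otimes> \<alpha>\<^sub>0" by (auto simp: fixpts_def)
  have "inv \<alpha> \<otimes> F \<alpha> = inv \<alpha>\<^sub>0 \<otimes> (inv s \<otimes> s) \<otimes> F \<alpha>\<^sub>0"
    using s a by (simp only: F_mult inv_mult_group m_assoc inv_closed m_closed F_closed)
  then show "\<alpha> \<in> {\<alpha> \<in> carrier G. inv \<alpha> \<otimes> F \<alpha> = inv \<alpha>\<^sub>0 \<otimes> F \<alpha>\<^sub>0}" using s a by simp
qed

lemma dual_lang_fibre:
  assumes a: "\<alpha>\<^sub>0 \<in> carrier G"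
  shows "{\<alpha> \<in> carrier G. (F ^^ N) \<alpha> \<otimes> inv \<alpha> = (F ^^ N) \<alpha>\<^sub>0 \<otimes> inv \<alpha>\<^sub>0} = (\<lambda>h. \<alpha>\<^sub>0 \<otimes> h) ` fixpts G F N"
proof (intro equalityI subsetI)
  fix \<alpha> assume "\<alpha> \<in> {\<alpha> \<in> carrier G. (F ^^ N) \<alpha> \<otimes> inv \<alpha> = (F ^^ N) \<alpha>\<^sub>0 \<otimes> inv \<alpha>\<^sub>0}"
  then have \<alpha>: "\<alpha> \<in> carrier G" and eq: "(F ^^ N) \<alpha> \<otimes> inv \<alpha> = (F ^^ N) \<alpha>\<^sub>0 \<otimes> inv \<alpha>\<^sub>0" by auto
  have "(F ^^ N) (inv \<alpha>\<^sub>0 \<otimes> \<alpha>) = inv ((F ^^ N) \<alpha>\<^sub>0) \<otimes> ((F ^^ N) \<alpha> \<otimes> inv \<alpha>) \<otimes> \<alpha>"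
    using \<alpha> a by (simp add: Fpow_mult Fpow_inv m_assoc)
  also have "\<dots> = inv \<alpha>\<^sub>0 \<otimes> \<alpha>" unfolding eq using \<alpha> a by (simp add: m_assoc[symmetric])
  finally have "inv \<alpha>\<^sub>0 \<otimes> \<alpha> \<in> fixpts G F N" using \<alpha> a by (simp add: fixpts_def)
  moreover have "\<alpha> = \<alpha>\<^sub>0 \<otimes> (inv \<alpha>\<^sub>0 \<otimes> \<alpha>)" using \<alpha> a by (simp add: m_assoc[symmetric])
  ultimately show "\<alpha> \<in> (\<lambda>h. \<alpha>\<^sub>0 \<otimes> h) ` fixpts G F N" by blast
next
  fix \<alpha> assume "\<alpha> \<in> (\<lambda>h. \<alpha>\<^sub>0 \<otimes> h) ` fixpts G F N"
  then obtain h where h: "h \<in> carrier G" "(F ^^ N) h = h" "\<alpha> = \<alpha>\<^sub>0 \<otimes> h" by (auto simp: fixpts_def)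
  have "(F ^^ N) \<alpha> \<otimes> inv \<alpha> = (F ^^ N) \<alpha>\<^sub>0 \<otimes> (h \<otimes> inv h) \<otimes> inv \<alpha>\<^sub>0"
    using h a by (simp only: Fpow_mult inv_mult_group m_assoc inv_closed m_closed Fpow_closed)
  then show "\<alpha> \<in> {\<alpha> \<in> carrier G. (F ^^ N) \<alpha> \<otimes> inv \<alpha> = (F ^^ N) \<alpha>\<^sub>0 \<otimes> inv \<alpha>\<^sub>0}" using h a by simp
qed

text \<open>Lang's theorem for y^-1 gives \<beta>, and \<alpha> = \<beta>^-1 solves the equation for
  y.\<close>

lemma dual_lang:
  assumes "k \<ge> 1" "y \<in> carrier G"
  shows "\<exists>\<alpha>\<in>carrier G. y = (F ^^ k) \<alpha> \<otimes> inv \<alpha>"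
proof -
  obtain \<beta> where \<beta>: "\<beta> \<in> carrier G" "inv y = inv \<beta> \<otimes> (F ^^ k) \<beta>"
    using lang[OF assms(1), of "inv y"] assms(2) by auto
  have "y = inv (inv \<beta> \<otimes> (F ^^ k) \<beta>)" using \<beta>(2) assms(2) by (metis inv_inv)
  also have "\<dots> = (F ^^ k) (inv \<beta>) \<otimes> inv (inv \<beta>)" using \<beta>(1) by (simp add: inv_mult_group Fpow_inv)
  finally show ?thesis using \<beta>(1) by blast
qed

text \<open>Both sides are averages of \<open>f (\<alpha>\<^sup>-\<^sup>1 F\<^sup>r(\<alpha>))\<close> over the finite set of all \<open>\<alpha>\<close> with
  \<open>\<alpha>\<^sup>-\<^sup>1 F(\<alpha>)\<close> fixed by \<open>F\<^bsup>rm\<^esup>\<close>. This set fibres over the fixed points of \<open>F\<^bsup>rm\<^esup>\<close> via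
  \<open>\<alpha>\<^sup>-\<^sup>1 F(\<alpha>)\<close> and over those of \<open>F\<close> via \<open>F\<^bsup>rm\<^esup>(\<alpha>) \<alpha>\<^sup>-\<^sup>1\<close>.\<close>

lemma average_norm_eq_m_avg_shintani:
  assumes rm: "r * m \<ge> 1"
    and f: "\<And>x h. x \<in> fixpts G F (r * m) \<Longrightarrow> h \<in> fixpts G F (r * m)
      \<Longrightarrow> f (inv h \<otimes> x \<otimes> (F ^^ r) h) = f x"
  shows "(\<Sum>g\<in>fixpts G F (r * m). f (normr G F r g)) / of_nat (card (fixpts G F (r * m)))
    = m_avg G F (shintani G F r m f)"
proof -
  let ?H = "fixpts G F (r * m)" and ?K = "fixpts G F 1"
  let ?u = "\<lambda>\<alpha>. inv \<alpha> \<otimes> F \<alpha>" and ?y = "\<lambda>\<alpha>. (F ^^ (r * m)) \<alpha> \<otimes> inv \<alpha>"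
  define X where "X = {\<alpha> \<in> carrier G. ?u \<alpha> \<in> ?H}"
  have X': "X = {\<alpha> \<in> carrier G. ?y \<alpha> \<in> ?K}" using lang_fixpts_iff by (auto simp: X_def)
  have finH: "finite ?H" and finK: "finite ?K" using rm by (auto intro: finite_fixpts)
  have card0: "of_nat (card ?H) \<noteq> (0 :: complex)" "of_nat (card ?K) \<noteq> (0 :: complex)"
    using finH finK subgroup.one_closed[OF fixpts_subgroup] by auto
  have fibre_u: "finite {\<alpha> \<in> X. ?u \<alpha> = g} \<and> card {\<alpha> \<in> X. ?u \<alpha> = g} = card ?K" if g: "g \<in> ?H" for g
  proof -
    obtain \<alpha>\<^sub>0 where a: "\<alpha>\<^sub>0 \<in> carrier G" "g = ?u \<alpha>\<^sub>0" using lang[of 1 g] fixpts_closed[OF g] by auto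
    have "{\<alpha> \<in> X. ?u \<alpha> = g} = {\<alpha> \<in> carrier G. ?u \<alpha> = ?u \<alpha>\<^sub>0}" using g a by (auto simp: X_def)
    also have "\<dots> = (\<lambda>s. s \<otimes> \<alpha>\<^sub>0) ` ?K" by (rule lang_fibre[OF a(1)])
    finally have eq: "{\<alpha> \<in> X. ?u \<alpha> = g} = (\<lambda>s. s \<otimes> \<alpha>\<^sub>0) ` ?K" .
    moreover have "inj_on (\<lambda>s. s \<otimes> \<alpha>\<^sub>0) ?K" using a(1) fixpts_closed by (auto intro!: inj_onI)
    ultimately show ?thesis using finK by (simp add: card_image)
  qed
  have "X = (\<Union>g\<in>?H. {\<alpha> \<in> X. ?u \<alpha> = g})" by (auto simp: X_def)
  \<comment> \<open>G may be infinite; X is finite as a union of finitely many finite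
    fibres.\<close>
  then have finX: "finite X" using fibre_u finH by (metis (no_types, lifting) finite_UN_I)
  have "(\<Sum>\<alpha>\<in>X. f (inv \<alpha> \<otimes> (F ^^ r) \<alpha>)) = (\<Sum>g\<in>?H. \<Sum>\<alpha>\<in>{\<alpha> \<in> X. ?u \<alpha> = g}. f (inv \<alpha> \<otimes> (F ^^ r) \<alpha>))"
    by (rule sum.group[symmetric]) (use finX finH in \<open>auto simp: X_def\<close>)
  also have "\<dots> = (\<Sum>g\<in>?H. \<Sum>\<alpha>\<in>{\<alpha> \<in> X. ?u \<alpha> = g}. f (normr G F r g))"
    by (intro sum.cong refl) (auto simp: X_def normr_lang)
  also have "\<dots> = of_nat (card ?K) * (\<Sum>g\<in>?H. f (normr G F r g))"
    using fibre_u by (simp add: sum_distrib_left)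
  finally have 1: "(\<Sum>\<alpha>\<in>X. f (inv \<alpha> \<otimes> (F ^^ r) \<alpha>)) = of_nat (card ?K) * (\<Sum>g\<in>?H. f (normr G F r g))" .
  have fibre_y: "(\<Sum>\<alpha>\<in>{\<alpha> \<in> X. ?y \<alpha> = s}. f (inv \<alpha> \<otimes> (F ^^ r) \<alpha>))
      = of_nat (card ?H) * shintani G F r m f s" if s: "s \<in> ?K" for s
  proof -
    \<comment> \<open>This is literally the choice made in \<open>shintani\<close>. The other points
      of the fibre are \<alpha>_0 h, where the value is the same because \<open>f\<close> is
      invariant under twisted conjugation.\<close>
    define \<alpha>\<^sub>0 where "\<alpha>\<^sub>0 = (SOME \<alpha>. \<alpha> \<in> carrier G \<and> s = (F ^^ (r * m)) \<alpha> \<otimes> inv \<alpha>)"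
    have "\<exists>\<alpha>. \<alpha> \<in> carrier G \<and> s = (F ^^ (r * m)) \<alpha> \<otimes> inv \<alpha>"
      using dual_lang[OF rm fixpts_closed[OF s]] by blast
    from someI_ex[OF this] have a: "\<alpha>\<^sub>0 \<in> carrier G" "s = ?y \<alpha>\<^sub>0" by (auto simp: \<alpha>\<^sub>0_def)
    have sh: "shintani G F r m f s = f (inv \<alpha>\<^sub>0 \<otimes> (F ^^ r) \<alpha>\<^sub>0)"
      by (simp add: shintani_def Let_def \<alpha>\<^sub>0_def)
    have "{\<alpha> \<in> X. ?y \<alpha> = s} = {\<alpha> \<in> carrier G. ?y \<alpha> = ?y \<alpha>\<^sub>0}" using s a by (auto simp: X')
    also have "\<dots> = (\<lambda>h. \<alpha>\<^sub>0 \<otimes> h) ` ?H" by (rule dual_lang_fibre[OF a(1)])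
    finally have eq: "{\<alpha> \<in> X. ?y \<alpha> = s} = (\<lambda>h. \<alpha>\<^sub>0 \<otimes> h) ` ?H" .
    have "\<alpha>\<^sub>0 \<in> X" using a s by (simp add: X')
    \<comment> \<open>The argument of \<open>f\<close> is the norm of an element of the finite
      group, hence lies in that group; the invariance of \<open>f\<close> is available only
      there.\<close>
    then have x: "inv \<alpha>\<^sub>0 \<otimes> (F ^^ r) \<alpha>\<^sub>0 \<in> ?H"
      using normr_fixpts[of "?u \<alpha>\<^sub>0" "r * m" r] a(1) by (simp add: X_def normr_lang)
    have val: "f (inv (\<alpha>\<^sub>0 \<otimes> h) \<otimes> (F ^^ r) (\<alpha>\<^sub>0 \<otimes> h)) = shintani G F r m f s" if h: "h \<in> ?H" for h
    proof -
      have "inv (\<alpha>\<^sub>0 \<otimes> h) \<otimes> (F ^^ r) (\<alpha>\<^sub>0 \<otimes> h) = inv h \<otimes> (inv \<alpha>\<^sub>0 \<otimes> (F ^^ r) \<alpha>\<^sub>0) \<otimes> (F ^^ r) h"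
        using a(1) fixpts_closed[OF h] by (simp add: inv_mult_group Fpow_mult m_assoc)
      then show ?thesis using f[OF x h] by (simp add: sh)
    qed
    have "inj_on (\<lambda>h. \<alpha>\<^sub>0 \<otimes> h) ?H" using a(1) fixpts_closed by (auto intro!: inj_onI)
    then have "(\<Sum>\<alpha>\<in>{\<alpha> \<in> X. ?y \<alpha> = s}. f (inv \<alpha> \<otimes> (F ^^ r) \<alpha>)) = (\<Sum>h\<in>?H. shintani G F r m f s)"
      unfolding eq by (subst sum.reindex) (simp_all add: val)
    then show ?thesis by simp
  qed
  have "(\<Sum>\<alpha>\<in>X. f (inv \<alpha> \<otimes> (F ^^ r) \<alpha>)) = (\<Sum>s\<in>?K. \<Sum>\<alpha>\<in>{\<alpha> \<in> X. ?y \<alpha> = s}. f (inv \<alpha> \<otimes> (F ^^ r) \<alpha>))"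
    by (rule sum.group[symmetric]) (use finX finK in \<open>auto simp: X'\<close>)
  also have "\<dots> = of_nat (card ?H) * (\<Sum>s\<in>?K. shintani G F r m f s)"
    by (simp add: fibre_y sum_distrib_left)
  finally show ?thesis using 1 card0 by (simp add: m_avg_def field_simps)
qed

end

section \<open>The modules and their tensor product\<close>

locale shintani_data = frobenius_group +
  fixes r m n :: nat and \<rho> :: "nat \<Rightarrow> 'a \<Rightarrow> complex mat" and T :: "nat \<Rightarrow> complex mat"
  assumes r: "r \<ge> 1" and m: "m \<ge> 1"
    and rep: "\<And>i. i < r \<Longrightarrow> is_rep G (fixpts G F (r * m)) n (\<rho> i)"
    and T_mat: "\<And>i. i < r \<Longrightarrow> T i \<in> carrier_mat n n \<and> invertible_mat (T i)"
    and T_intertw: "\<And>i g. i < r \<Longrightarrow> g \<in> fixpts G F (r * m)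
      \<Longrightarrow> T i * \<rho> i g = \<rho> ((i + 1) mod r) (F g) * T i"
    and T_order: "mat_cprod n T r ^\<^sub>m m = 1\<^sub>m n"
begin

abbreviation "H \<equiv> fixpts G F (r * m)"

lemma rm: "r * m \<ge> 1"
  using r m by simp

lemma H_sub: "subgroup H G" and H_fin: "finite H" and H_ne: "H \<noteq> {}"
  using fixpts_subgroup finite_fixpts[OF rm] subgroup.one_closed[OF fixpts_subgroup] by auto

lemma \<rho>_carrier: "i < r \<Longrightarrow> g \<in> H \<Longrightarrow> \<rho> i g \<in> carrier_mat n n"
  using is_rep_carrier[OF rep] .

lemma T_carrier: "i < r \<Longrightarrow> T i \<in> carrier_mat n n"
  using T_mat by blast

lemma cprod_T_carrier: "k \<le> r \<Longrightarrow> mat_cprod n T k \<in> carrier_mat n n"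
  using T_carrier by (intro mat_cprod_carrier) auto

lemma cprod_T_intertwine:
  assumes "g \<in> H" "k \<le> r"
  shows "mat_cprod n T k * \<rho> 0 g = \<rho> (k mod r) ((F ^^ k) g) * mat_cprod n T k"
  using assms(2)
proof (induction k)
  case 0
  then show ?case using \<rho>_carrier[of 0 g] r assms by simp
next
  case (Suc k)
  then have k: "k < r" by simp
  have Fg: "(F ^^ k) g \<in> H" using assms by (simp add: Fpow_fixpts)
  have Sk: "Suc k mod r < r" using r by simp
  note c = \<rho>_carrier[OF k Fg] \<rho>_carrier[OF Sk F_fixpts[OF Fg]] T_carrier[OF k] cprod_T_carrier[of k]
    \<rho>_carrier[of 0 g]
  have "mat_cprod n T (Suc k) * \<rho> 0 g = T k * (mat_cprod n T k * \<rho> 0 g)"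
    using c k r assms by (simp add: assoc_mult_mat[of _ n n _ n _ n])
  also have "\<dots> = T k * \<rho> k ((F ^^ k) g) * mat_cprod n T k"
    using Suc k c by (simp add: assoc_mult_mat[of _ n n _ n _ n])
  also have "T k * \<rho> k ((F ^^ k) g) = \<rho> (Suc k mod r) (F ((F ^^ k) g)) * T k"
    using T_intertw[OF k Fg] by simp
  also have "\<dots> * mat_cprod n T k = \<rho> (Suc k mod r) ((F ^^ Suc k) g) * mat_cprod n T (Suc k)"
    using c k by (simp add: assoc_mult_mat[of _ n n _ n _ n])
  finally show ?case .
qed

text \<open>In the semidirect product, h^-1 x F^r(h) \<sigma>^r is the conjugate of x \<sigma>^r by
  h^-1. On matrices this is the relation \<rho>_0(F^r(h)) T = T \<rho>_0(h) for the full product T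
  of the T's.\<close>

lemma xi_tilde_twisted_class_function:
  assumes x: "x \<in> H" and h: "h \<in> H"
  shows "xi_tilde_sr n r \<rho> T (inv h \<otimes> x \<otimes> (F ^^ r) h) = xi_tilde_sr n r \<rho> T x"
proof -
  have 0: "0 < r" using r by simp
  have ih: "inv h \<in> H" using subgroup.m_inv_closed[OF H_sub h] .
  have Fh: "(F ^^ r) h \<in> H" using h by (rule Fpow_fixpts)
  note \<rho> = rep[OF 0]
  note c = is_rep_carrier[OF \<rho> x] is_rep_carrier[OF \<rho> h] is_rep_carrier[OF \<rho> ih] is_rep_carrier[OF \<rho> Fh]
    cprod_T_carrier[of r, simplified]
  have "\<rho> 0 (inv h \<otimes> x \<otimes> (F ^^ r) h) * mat_cprod n T r
      = \<rho> 0 (inv h) * \<rho> 0 x * (\<rho> 0 ((F ^^ r) h) * mat_cprod n T r)"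
    using c x ih Fh subgroup.m_closed[OF H_sub ih x]
    by (simp add: is_rep_mult[OF \<rho>] assoc_mult_mat[of _ n n _ n _ n] mult_carrier_mat[of _ n n _ n])
  also have "\<rho> 0 ((F ^^ r) h) * mat_cprod n T r = mat_cprod n T r * \<rho> 0 h"
    using cprod_T_intertwine[OF h, of r] by simp
  also have "\<rho> 0 (inv h) * \<rho> 0 x * (mat_cprod n T r * \<rho> 0 h)
      = \<rho> 0 (inv h) * (\<rho> 0 x * mat_cprod n T r) * \<rho> 0 h"
    using c by (simp add: assoc_mult_mat[of _ n n _ n _ n] mult_carrier_mat[of _ n n _ n])
  also have "mat_trace \<dots> = mat_trace (\<rho> 0 x * mat_cprod n T r)"
    using c is_rep_inv(1)[OF H_sub \<rho> h]
    by (intro mat_trace_conj[of _ n]) (auto intro!: mult_carrier_mat[of _ n n _ n])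
  finally show ?thesis by (simp add: xi_tilde_sr_def)
qed

text \<open>The factor with i = 0 contributes T (r - 1), which stays at the far right. Every other
  T_k is moved right past the part already collected, applying F to it, and N_(k+2)(x) = x
  F(N_(k+1)(x)) keeps that part a norm.\<close>

lemma cprod_rho_T:
  assumes x: "x \<in> H" and k: "k < r"
  shows "mat_cprod n (\<lambda>i. \<rho> i x * T ((i + r - 1) mod r)) (Suc k)
    = \<rho> k (normr G F (Suc k) x) * (mat_cprod n T k * T (r - 1))"
  using k
proof (induction k)
  case 0
  have "\<rho> 0 x \<in> carrier_mat n n" "T (r - 1) \<in> carrier_mat n n"
    using x r \<rho>_carrier T_carrier by auto
  then show ?case using 0 fixpts_closed[OF x] by (simp add: mult_carrier_mat[of _ n n _ n])
next
  case (Suc k)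
  then have k: "k < r" and idx: "(Suc k + r - 1) mod r = k" by auto
  have N: "normr G F (Suc k) x \<in> H" using x by (rule normr_fixpts)
  note c = \<rho>_carrier[OF Suc.prems x] \<rho>_carrier[OF k N] T_carrier[OF k] \<rho>_carrier[OF Suc.prems F_fixpts[OF N]]
  have Pc: "mat_cprod n T k * T (r - 1) \<in> carrier_mat n n"
    using cprod_T_carrier[of k] T_carrier[of "r - 1"] k by (auto intro!: mult_carrier_mat[of _ n n _ n])
  have "mat_cprod n (\<lambda>i. \<rho> i x * T ((i + r - 1) mod r)) (Suc (Suc k))
      = \<rho> (Suc k) x * T k * (\<rho> k (normr G F (Suc k) x) * (mat_cprod n T k * T (r - 1)))"
    by (subst mat_cprod.simps(2), subst Suc.IH[OF k]) (simp only: idx)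
  also have "\<dots> = \<rho> (Suc k) x * (T k * \<rho> k (normr G F (Suc k) x)) * (mat_cprod n T k * T (r - 1))"
    using c Pc by (simp add: assoc_mult_mat[of _ n n _ n _ n] mult_carrier_mat[of _ n n _ n] del: normr.simps)
  also have "T k * \<rho> k (normr G F (Suc k) x) = \<rho> (Suc k) (F (normr G F (Suc k) x)) * T k"
    using T_intertw[OF k N] Suc.prems by simp
  also have "\<rho> (Suc k) x * (\<rho> (Suc k) (F (normr G F (Suc k) x)) * T k) * (mat_cprod n T k * T (r - 1))
      = (\<rho> (Suc k) x * \<rho> (Suc k) (F (normr G F (Suc k) x))) * (T k * (mat_cprod n T k * T (r - 1)))"
    using c Pc by (simp add: assoc_mult_mat[of _ n n _ n _ n] mult_carrier_mat[of _ n n _ n] del: normr.simps)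
  also have "\<rho> (Suc k) x * \<rho> (Suc k) (F (normr G F (Suc k) x)) = \<rho> (Suc k) (normr G F (Suc (Suc k)) x)"
    by (simp only: normr_Suc_left[OF fixpts_closed[OF x], of "Suc k"]
        is_rep_mult[OF rep[OF Suc.prems] x F_fixpts[OF N]])
  also have "T k * (mat_cprod n T k * T (r - 1)) = mat_cprod n T (Suc k) * T (r - 1)"
    using c cprod_T_carrier[of k] T_carrier[of "r - 1"] k by (simp add: assoc_mult_mat[of _ n n _ n _ n])
  finally show ?case .
qed

text \<open>The trace of a rotated tensor product is the trace of the cyclic product of its factors;
  moving every \<open>T\<^sub>i\<close> to the right turns the remaining factors into a norm.\<close>

lemma phi0_tilde_eq_xi_tilde_normr:
  assumes x: "x \<in> H"
  shows "phi0_tilde_s n r \<rho> T x = xi_tilde_sr n r \<rho> T (normr G F r (F x))"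
proof -
  let ?A = "\<lambda>i. \<rho> i x * T ((i + r - 1) mod r)"
  define k where "k = r - 1"
  have k: "r = Suc k" "k < r" using r by (auto simp: k_def)
  let ?N = "normr G F r x"
  have N: "?N \<in> H" using x by (rule normr_fixpts)
  have A: "?A i \<in> carrier_mat n n" if "i < r" for i
    using \<rho>_carrier[OF that x] T_carrier[of "(i + r - 1) mod r"] r
    by (intro mult_carrier_mat[of _ n n _ n]) auto
  have FN: "\<rho> 0 (F ?N) \<in> carrier_mat n n" using \<rho>_carrier[of 0 "F ?N"] F_fixpts[OF N] r by simp
  note c = \<rho>_carrier[OF k(2) N] T_carrier[OF k(2)] cprod_T_carrier[of k] FN
  have "phi0_tilde_s n r \<rho> T x = mat_trace (tensor_mat r n (r - 1) ?A)"
    using r by (simp add: phi0_tilde_s_def mat_trace_tensor_mat tensor_index_def)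
  also have "\<dots> = mat_trace (mat_cprod n ?A r)"
    using r by (intro mat_trace_rotated_tensor_mat A) auto
  also have "mat_cprod n ?A r = \<rho> k ?N * (mat_cprod n T k * T k)"
    using cprod_rho_T[OF x k(2)] by (simp only: k(1)[symmetric] k_def[symmetric])
  also have "\<dots> = \<rho> k ?N * mat_cprod n T k * T k"
    using c k by (simp add: assoc_mult_mat[of _ n n _ n _ n])
  \<comment> \<open>The last intertwiner is brought to the front by cyclicity of the trace; letting
    it pass the norm completes the cycle and costs the one extra F.\<close>
  also have "mat_trace \<dots> = mat_trace (T k * (\<rho> k ?N * mat_cprod n T k))"
    by (rule mat_trace_mult_commute[of _ n n]) (use c k in \<open>auto intro!: mult_carrier_mat[of _ n n _ n]\<close>)
  also have "T k * (\<rho> k ?N * mat_cprod n T k) = T k * \<rho> k ?N * mat_cprod n T k"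
    using c k by (simp add: assoc_mult_mat[of _ n n _ n _ n])
  also have "T k * \<rho> k ?N = \<rho> 0 (F ?N) * T k"
    using T_intertw[OF k(2) N] k by simp
  also have "\<rho> 0 (F ?N) * T k * mat_cprod n T k = \<rho> 0 (F ?N) * mat_cprod n T r"
    using c k by (simp add: assoc_mult_mat[of _ n n _ n _ n])
  finally show ?thesis
    by (simp add: xi_tilde_sr_def normr_F[OF fixpts_closed[OF x]])
qed

section \<open>The projection onto invariants and the action of \<sigma>\<close>

abbreviation "d \<equiv> tensor_dim r n"
definition "tensor_rep g = tensor_mat r n 0 (\<lambda>i. \<rho> i g)"
definition "sigma_mat = tensor_mat r n (r - 1) (\<lambda>i. T ((i + r - 1) mod r))"
definition "invariants_proj = mat_avg H d tensor_rep"

lemma tensor_action_carrier [simp]: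
  "tensor_rep g \<in> carrier_mat d d" "sigma_mat \<in> carrier_mat d d" "invariants_proj \<in> carrier_mat d d"
  by (simp_all add: tensor_rep_def sigma_mat_def invariants_proj_def)

text \<open>This is \<sigma> g \<sigma>^-1 = F(g) on the tensor product: leg i receives leg i - 1
  through T_(i-1), which turns \<rho>_(i-1)(g) into \<rho>_i(F(g)).\<close>

lemma sigma_mat_tensor_rep: "g \<in> H \<Longrightarrow> sigma_mat * tensor_rep g = tensor_rep (F g) * sigma_mat"
proof -
  assume g: "g \<in> H"
  have "sigma_mat * tensor_rep g = tensor_mat r n (r - 1 + 0) (\<lambda>i. T ((i + r - 1) mod r) * \<rho> ((i + (r - 1)) mod r) g)"
    unfolding sigma_mat_def tensor_rep_def using g r by (intro tensor_mat_mult T_carrier \<rho>_carrier) auto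
  also have "\<dots> = tensor_mat r n (0 + (r - 1)) (\<lambda>i. \<rho> i (F g) * T (((i + 0) mod r + r - 1) mod r))"
  proof (rule tensor_mat_cong)
    fix i assume i: "i < r"
    have "(i + r - 1) mod r < r" using r by simp
    moreover have "((i + r - 1) mod r + 1) mod r = i"
      using i r by (simp add: mod_simps)
    ultimately have "T ((i + r - 1) mod r) * \<rho> ((i + r - 1) mod r) g = \<rho> i (F g) * T ((i + r - 1) mod r)"
      using T_intertw[of "(i + r - 1) mod r" g] g by simp
    then show "T ((i + r - 1) mod r) * \<rho> ((i + (r - 1)) mod r) g
        = \<rho> i (F g) * T (((i + 0) mod r + r - 1) mod r)" using i r by simp
  qed simp
  also have "\<dots> = tensor_rep (F g) * sigma_mat"
    unfolding sigma_mat_def tensor_rep_def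
    using F_fixpts[OF g] r by (intro tensor_mat_mult[symmetric] T_carrier \<rho>_carrier) auto
  finally show ?thesis .
qed

lemma tensor_rep_mult: "g \<in> H \<Longrightarrow> h \<in> H \<Longrightarrow> tensor_rep g * tensor_rep h = tensor_rep (g \<otimes> h)"
proof -
  assume g: "g \<in> H" and h: "h \<in> H"
  have "tensor_rep g * tensor_rep h = tensor_mat r n (0 + 0) (\<lambda>i. \<rho> i g * \<rho> ((i + 0) mod r) h)"
    unfolding tensor_rep_def using g h by (intro tensor_mat_mult \<rho>_carrier)
  also have "\<dots> = tensor_rep (g \<otimes> h)"
    unfolding tensor_rep_def using is_rep_mult[OF rep g h] by (intro tensor_mat_cong) auto
  finally show ?thesis .
qed

lemma invariants_proj_idem: "invariants_proj * invariants_proj = invariants_proj"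
proof -
  have "invariants_proj * invariants_proj = mat_avg H d (\<lambda>g. tensor_rep g * invariants_proj)"
    unfolding invariants_proj_def by (rule mat_avg_mult_right) simp_all
  also have "\<dots> = mat_avg H d (\<lambda>_. invariants_proj)"
  proof (rule mat_avg_cong)
    fix g assume g: "g \<in> H"
    have "tensor_rep g * invariants_proj = mat_avg H d (\<lambda>h. tensor_rep g * tensor_rep h)"
      unfolding invariants_proj_def by (rule mat_avg_mult_left) simp_all
    also have "\<dots> = mat_avg H d (\<lambda>h. tensor_rep (g \<otimes> h))"
      using g by (intro mat_avg_cong tensor_rep_mult)
    also have "\<dots> = invariants_proj"
      unfolding invariants_proj_def by (rule mat_avg_reindex[OF subgroup_bij_mult_left[OF H_sub g]])
    finally show "tensor_rep g * invariants_proj = invariants_proj" .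
  qed
  also have "\<dots> = invariants_proj" using H_fin H_ne by (intro mat_avg_const) simp_all
  finally show ?thesis .
qed

lemma invariants_proj_sigma_mat: "invariants_proj * sigma_mat = mat_avg H d (\<lambda>g. tensor_rep g * sigma_mat)"
  unfolding invariants_proj_def by (rule mat_avg_mult_right) simp_all

lemma invariants_proj_sigma_mat_commute: "invariants_proj * sigma_mat = sigma_mat * invariants_proj"
proof -
  have "sigma_mat * invariants_proj = mat_avg H d (\<lambda>g. sigma_mat * tensor_rep g)"
    unfolding invariants_proj_def by (rule mat_avg_mult_left) simp_all
  also have "\<dots> = mat_avg H d (\<lambda>g. tensor_rep (F g) * sigma_mat)" by (intro mat_avg_cong sigma_mat_tensor_rep)
  also have "\<dots> = mat_avg H d (\<lambda>g. tensor_rep g * sigma_mat)" by (rule mat_avg_reindex[OF F_bij_fixpts[OF rm]])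
  finally show ?thesis by (simp add: invariants_proj_sigma_mat)
qed

lemma sigma_mat_order: "sigma_mat ^\<^sub>m (r * m) = 1\<^sub>m d"
  unfolding sigma_mat_def using r by (intro rotated_tensor_mat_order T_mat T_order) auto

lemma mat_trace_invariants_proj:
  "mat_trace invariants_proj = M_avg G F (r * m) (\<lambda>x. \<Prod>i<r. mat_trace (\<rho> i x))"
proof -
  have "mat_trace invariants_proj = (\<Sum>g\<in>H. mat_trace (tensor_rep g)) / of_nat (card H)"
    unfolding invariants_proj_def by (rule mat_trace_avg) simp
  moreover have "mat_trace (tensor_rep g) = (\<Prod>i<r. mat_trace (\<rho> i g))" if "g \<in> H" for g
    unfolding tensor_rep_def using that by (intro mat_trace_tensor_mat_0 \<rho>_carrier)
  ultimately show ?thesis by (simp add: M_avg_def)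
qed

lemma mat_trace_invariants_proj_sigma:
  "mat_trace (invariants_proj * sigma_mat) = M_avg G F (r * m) (phi0_tilde_s n r \<rho> T)"
proof -
  have "mat_trace (invariants_proj * sigma_mat) = (\<Sum>g\<in>H. mat_trace (tensor_rep g * sigma_mat)) / of_nat (card H)"
    unfolding invariants_proj_sigma_mat
    by (rule mat_trace_avg) (auto intro: mult_carrier_mat[OF tensor_action_carrier(1,2)])
  moreover have "mat_trace (tensor_rep g * sigma_mat) = phi0_tilde_s n r \<rho> T g" if g: "g \<in> H" for g
  proof -
    have "tensor_rep g * sigma_mat = tensor_mat r n (0 + (r - 1)) (\<lambda>i. \<rho> i g * T (((i + 0) mod r + r - 1) mod r))"
      unfolding sigma_mat_def tensor_rep_def
      using g r by (intro tensor_mat_mult T_carrier \<rho>_carrier) auto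
    also have "\<dots> = tensor_mat r n (r - 1) (\<lambda>i. \<rho> i g * T ((i + r - 1) mod r))"
      by (intro tensor_mat_cong) auto
    finally show ?thesis
      using r by (simp add: phi0_tilde_s_def mat_trace_tensor_mat tensor_index_def)
  qed
  ultimately show ?thesis by (simp add: M_avg_def)
qed

lemma average_norm_eq_m_avg_R:
  "(\<Sum>g\<in>H. xi_tilde_sr n r \<rho> T (normr G F r g)) / of_nat (card H)
    = m_avg G F (shintani G F r m (xi_tilde_sr n r \<rho> T))"
  using rm xi_tilde_twisted_class_function by (rule average_norm_eq_m_avg_shintani)

lemma m_avg_R_eq_M_avg_phi0:
  "m_avg G F (shintani G F r m (xi_tilde_sr n r \<rho> T)) = M_avg G F (r * m) (phi0_tilde_s n r \<rho> T)"
proof -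
  have "(\<Sum>g\<in>H. phi0_tilde_s n r \<rho> T g) = (\<Sum>g\<in>H. xi_tilde_sr n r \<rho> T (normr G F r (F g)))"
    by (intro sum.cong refl phi0_tilde_eq_xi_tilde_normr)
  also have "\<dots> = (\<Sum>g\<in>H. xi_tilde_sr n r \<rho> T (normr G F r g))"
    by (rule sum.reindex_bij_betw[OF F_bij_fixpts[OF rm]])
  finally show ?thesis by (simp add: M_avg_def average_norm_eq_m_avg_R[symmetric])
qed

text \<open>The periodicity lemma is applied to E S with N = rm. Since (E S)^(rm) = E, the number of
  nonzero eigenvalues is the trace of E, that is \<open>Mprod\<close>.\<close>

lemma m_avg_R_bounds:
  fixes R Mprod defines "R \<equiv> m_avg G F (shintani G F r m (xi_tilde_sr n r \<rho> T))"
    and "Mprod \<equiv> M_avg G F (r * m) (\<lambda>x. \<Prod>i<r. mat_trace (\<rho> i x))"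
  shows "cmod R \<le> Re Mprod" and "Mprod = 1 \<Longrightarrow> R ^ (r * m) = 1"
proof -
  have R: "R = mat_trace (invariants_proj * sigma_mat)"
    by (simp add: R_def m_avg_R_eq_M_avg_phi0 mat_trace_invariants_proj_sigma)
  have N: "r * m > 0" using rm by simp
  note fin = idempotent_mult_finite_order[OF tensor_action_carrier(3,2) invariants_proj_idem
      invariants_proj_sigma_mat_commute sigma_mat_order N]
  have c: "invariants_proj * sigma_mat \<in> carrier_mat d d" by (rule mult_carrier_mat[OF tensor_action_carrier(3,2)])
  have M: "Mprod = mat_trace ((invariants_proj * sigma_mat) ^\<^sub>m (r * m))"
    by (simp only: fin(1) Mprod_def mat_trace_invariants_proj)
  show "cmod R \<le> Re Mprod" "Mprod = 1 \<Longrightarrow> R ^ (r * m) = 1"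
    using mat_trace_of_periodic[OF c N fin(2)] by (simp_all add: R M)
qed

end

theorem theorem1p14:
  fixes G :: "('a, 'b) monoid_scheme" and F :: "'a \<Rightarrow> 'a"
    and r m n :: nat and \<xi> :: "'a \<Rightarrow> complex"
    and \<rho> :: "nat \<Rightarrow> 'a \<Rightarrow> complex mat" and T :: "nat \<Rightarrow> complex mat"
  defines "H \<equiv> fixpts G F (r * m)"
  assumes setting: "frob_setting G F"
    and r: "r \<ge> 1" and m: "m \<ge> 1"
    and xi_stable: "\<forall>x\<in>H. frob_char F H r \<xi> x = \<xi> x"
    and V_irr: "\<forall>i<r. irreducible_rep G H n (\<rho> i)"
    and V_char: "\<forall>i<r. \<forall>x\<in>H. mat_trace (\<rho> i x) = frob_char F H i \<xi> x"
    and T_mat: "\<forall>i<r. T i \<in> carrier_mat n n \<and> invertible_mat (T i)"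
    and T_intertw: "\<forall>i<r. \<forall>g\<in>H. T i * \<rho> i g = \<rho> ((i + 1) mod r) (F g) * T i"
    and T_order: "mat_cprod n T r ^\<^sub>m m = 1\<^sub>m n"
  shows "(let xit = xi_tilde_sr n r \<rho> T;
              R = shintani G F r m xit;
              c = (\<Sum>g\<in>H. xit (normr G F r g)) / of_nat (card H);
              prodxi = (\<lambda>x. \<Prod>i<r. frob_char F H i \<xi> x);
              Mprod = M_avg G F (r * m) prodxi
          in c = m_avg G F R \<and> m_avg G F R = M_avg G F (r * m) (phi0_tilde_s n r \<rho> T)
             \<and> cmod (m_avg G F R) \<le> Re Mprod
             \<and> (Mprod = 1 \<longrightarrow> cmod (m_avg G F R) = 1)
             \<and> (r = 2 \<longrightarrow> (\<exists>\<zeta>. \<zeta> ^ (2 * m) = 1 \<and>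
                  (if (\<forall>x\<in>H. cnj (\<xi> x) = frob_char F H 1 \<xi> x) then m_avg G F R = \<zeta>
                   else m_avg G F R = 0))))"
proof -
  have rep: "is_rep G H n (\<rho> i)" if "i < r" for i using V_irr that by (simp add: irreducible_rep_def)
  interpret group G using setting by (simp add: frob_setting_def)
  interpret shintani_data G F r m n \<rho> T
    rewrites "fixpts G F (r * m) \<equiv> H"
    by (unfold_locales) (use setting r m rep T_mat T_intertw T_order in \<open>auto simp: H_def\<close>)
  define R where "R = m_avg G F (shintani G F r m (xi_tilde_sr n r \<rho> T))"
  define Mprod where "Mprod = M_avg G F (r * m) (\<lambda>x. \<Prod>i<r. frob_char F H i \<xi> x)"
  \<comment> \<open>The characters F^i(\<xi>) are exchanged for traces of the modules affording
    them, the form in which the bounds were obtained.\<close>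
  have Mprod_eq: "Mprod = M_avg G F (r * m) (\<lambda>x. \<Prod>i<r. mat_trace (\<rho> i x))"
    unfolding Mprod_def M_avg_def
    by (intro arg_cong2[where f = "(/)"] sum.cong prod.cong refl) (use V_char in \<open>auto simp: H_def\<close>)
  note bounds = m_avg_R_bounds[folded R_def Mprod_eq]
  have norm1: "cmod R = 1" if "Mprod = 1"
    using bounds(2)[OF that] r m by (intro cmod_root_of_unity) auto
  have part2: "\<exists>\<zeta>. \<zeta> ^ (2 * m) = 1 \<and>
      (if (\<forall>x\<in>H. cnj (\<xi> x) = frob_char F H 1 \<xi> x) then R = \<zeta> else R = 0)" if r2: "r = 2"
  proof -
    have lt: "0 < r" "1 < r" using r2 by auto
    have id: "the_inv_into H (F ^^ 0) x = x" if "x \<in> H" for x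
      using the_inv_into_f_f[of "F ^^ 0" H x] that by simp
    have xi: "\<xi> x = mat_trace (\<rho> 0 x)" and Fxi: "frob_char F H 1 \<xi> x = mat_trace (\<rho> 1 x)"
      if "x \<in> H" for x
      using V_char that lt id[OF that] by (auto simp: frob_char_def)
    have inv: "mat_trace (\<rho> 0 (inv\<^bsub>G\<^esub> x)) = cnj (mat_trace (\<rho> 0 x))" if "x \<in> H" for x
      using char_inv_eq_cnj[OF H_sub H_fin rep[OF lt(1)] that] .
    have M2: "Mprod = (\<Sum>g\<in>H. mat_trace (\<rho> 0 g) * mat_trace (\<rho> 1 g)) / of_nat (card H)"
      unfolding Mprod_eq M_avg_def H_def[symmetric] by (simp add: r2 numeral_2_eq_2 lessThan_Suc mult.commute)
    show ?thesis
    proof (cases "\<forall>x\<in>H. cnj (\<xi> x) = frob_char F H 1 \<xi> x")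
      case True
      \<comment> \<open>The assumption identifies the character of \<rho>_1 at g with that of
        \<rho>_0 at g^-1, so \<open>Mprod\<close> becomes the norm of an irreducible
        character.\<close>
      have "Mprod = (\<Sum>g\<in>H. mat_trace (\<rho> 0 g) * mat_trace (\<rho> 0 (inv\<^bsub>G\<^esub> g))) / of_nat (card H)"
        unfolding M2 by (intro arg_cong2[where f = "(/)"] sum.cong refl) (use True xi Fxi inv in auto)
      also have "\<dots> = 1" using V_irr lt by (intro char_orthogonality_self H_sub H_fin) auto
      finally have "R ^ (r * m) = 1" by (rule bounds(2))
      then show ?thesis using True r2 by auto
    next
      case False
      then obtain x where x: "x \<in> H" "cnj (\<xi> x) \<noteq> frob_char F H 1 \<xi> x" by blast
      have ix: "inv\<^bsub>G\<^esub> x \<in> H" using subgroup.m_inv_closed[OF H_sub x(1)] .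
      have "(\<Sum>g\<in>H. mat_trace (\<rho> 0 g) * mat_trace (\<rho> 1 g)) = 0"
      proof (rule char_orthogonality_distinct[OF H_sub])
        \<comment> \<open>The witness is x^-1: there \<rho>_0 has the character value cnj (\<xi> x),
          and the dual of \<rho>_1 has the value F(\<xi>)(x).\<close>
        have "mat_trace (\<rho> 0 (inv\<^bsub>G\<^esub> x)) \<noteq> mat_trace (\<rho> 1 (inv\<^bsub>G\<^esub> (inv\<^bsub>G\<^esub> x)))"
          using x xi Fxi inv subgroup.mem_carrier[OF H_sub x(1)] by simp
        then show "\<exists>h\<in>H. mat_trace (\<rho> 0 h) \<noteq> mat_trace (\<rho> 1 (inv\<^bsub>G\<^esub> h))" using ix by blast
      qed (use V_irr rep lt in auto)
      then have "Mprod = 0" by (simp add: M2)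
      then have "R = 0" using bounds(1) by simp
      \<comment> \<open>In this case \<zeta> does not occur in the conclusion about R, so 1 serves
        as the root of unity.\<close>
      then show ?thesis using False by (intro exI[of _ 1]) simp
    qed
  qed
  show ?thesis
    unfolding Let_def R_def[symmetric] Mprod_def[symmetric]
    using average_norm_eq_m_avg_R m_avg_R_eq_M_avg_phi0 bounds(1) norm1 part2
    by (simp add: R_def)
qed

end
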